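(* For every integer $n\geq 3$, \[ c_5(n)=\frac{L^*_3(n;\sigma_5)}{2}-\sum_{i=2}^{n-1}i\cdot\Lambda(n,i), \] where $\sigma_5=++-$.
   Context: $\mathcal S_n$ is the set of permutations of $[n]$ in one-line notation $\pi=\pi_1\cdots\pi_n$; $\mathcal C_n$ is the set of cyclic permutations (single $n$-cycle) in $\mathcal S_n$. For $\sigma=\sigma^0\cdots\sigma^{k-1}\in\{+,-\}^k$, $\mathcal S^\sigma_n$ is the set of $\pi\in\mathcal S_n$ for which there exist $0=e_0\le e_1\le\cdots\le e_k=n$ with each segment $\pi_{e_i+1}\cdots\pi_{e_{i+1}}$ increasing if $\sigma^i=+$ and decreasing if $\sigma^i=-$; $\mathcal C_n^\sigma=\mathcal C_n\cap\mathcal S_n^\sigma$. $c_5(n)=|\mathcal C_n^{++-}|$. $\Lambda(n,i)$ is the number of $\pi\in\mathcal C_n^{+-}$ (cyclic unimodal permutations) with $\pi_i=n$. A word of length $m$ on $k$ letters is $s=s_1\cdots s_m$ with $s_j\in\{0,\dots,k-1\}$; primitive means not of the form $q^r$ with $r>1$. Necklaces are rotation classes of words, primitive if their representatives are. $L_k(m)$ is the number of primitive necklaces of length $m$ on $k$ letters. With $T_\sigma^-=\{i:\sigma^i=-\}$ and $o_\sigma(s)=|\{j:s_j\in T_\sigma^-\}|$, $L_k(m;\sigma)$ is the number of primitive necklaces of length $m$ on $k$ letters with $o_\sigma(s)$ odd ($0$ if $m$ is not an integer), and $L_k^*(n;\sigma)=L_k(n)+L_k(\tfrac n2;\sigma)$.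 *)

theory Defs
  imports Complex_Main
begin

(* A permutation of [n] in one-line notation is a list xs with xs!(j-1) = pi_j. *)
definition perms :: "nat \<Rightarrow> nat list set" where
  "perms n = {xs. length xs = n \<and> distinct xs \<and> set xs = {1..n}}"

definition perm_fun :: "nat list \<Rightarrow> nat \<Rightarrow> nat" where
  "perm_fun xs i = xs ! (i - 1)"

definition cyclic_perms :: "nat \<Rightarrow> nat list set" where
  "cyclic_perms n = {xs \<in> perms n. {(perm_fun xs ^^ k) 1 | k. True} = {1..n}}"

(* sign patterns: True = '+', False = '-' *)
definition segment :: "nat list \<Rightarrow> nat \<Rightarrow> nat \<Rightarrow> nat list" where
  "segment xs a b = take (b - a) (drop a xs)"

definition shape_perms :: "bool list \<Rightarrow> nat \<Rightarrow> nat list set" where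
  "shape_perms \<sigma> n = {xs \<in> perms n. \<exists>e :: nat \<Rightarrow> nat.
      e 0 = 0 \<and> e (length \<sigma>) = n \<and> (\<forall>i < length \<sigma>. e i \<le> e (Suc i)) \<and>
      (\<forall>i < length \<sigma>.
         (if \<sigma> ! i then sorted_wrt (<) (segment xs (e i) (e (Suc i)))
          else sorted_wrt (>) (segment xs (e i) (e (Suc i)))))}"

definition cyclic_shape_perms :: "bool list \<Rightarrow> nat \<Rightarrow> nat list set" where
  "cyclic_shape_perms \<sigma> n = cyclic_perms n \<inter> shape_perms \<sigma> n"

definition c5 :: "nat \<Rightarrow> nat" where
  "c5 n = card (cyclic_shape_perms [True, True, False] n)"

definition Lambda :: "nat \<Rightarrow> nat \<Rightarrow> nat" where
  "Lambda n i = card {xs \<in> cyclic_shape_perms [True, False] n. perm_fun xs i = n}"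

definition words :: "nat \<Rightarrow> nat \<Rightarrow> nat list set" where
  "words k m = {s. length s = m \<and> set s \<subseteq> {0..<k}}"

definition primitive :: "nat list \<Rightarrow> bool" where
  "primitive s \<longleftrightarrow> \<not> (\<exists>q r. r > 1 \<and> s = concat (replicate r q))"

definition necklace :: "nat list \<Rightarrow> nat list set" where
  "necklace s = {rotate j s | j. True}"

definition prim_necklaces :: "nat \<Rightarrow> nat \<Rightarrow> nat list set set" where
  "prim_necklaces k m = necklace ` {s \<in> words k m. primitive s}"

definition L :: "nat \<Rightarrow> nat \<Rightarrow> nat" where
  "L k m = card (prim_necklaces k m)"

definition o_sigma :: "bool list \<Rightarrow> nat list \<Rightarrow> nat" where
  "o_sigma \<sigma> s = length (filter (\<lambda>c. c \<in> {i. i < length \<sigma> \<and> \<not> \<sigma> ! i}) s)"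

definition L_sigma :: "nat \<Rightarrow> nat \<Rightarrow> bool list \<Rightarrow> nat" where
  "L_sigma k m \<sigma> = card (necklace ` {s \<in> words k m. primitive s \<and> odd (o_sigma \<sigma> s)})"

definition L_star :: "nat \<Rightarrow> nat \<Rightarrow> bool list \<Rightarrow> nat" where
  "L_star k n \<sigma> = L k n + (if even n then L_sigma k (n div 2) \<sigma> else 0)"

end

theory Submission
  imports Defs "HOL-Library.Omega_Words_Fun" "HOL-Combinatorics.Orbits"
begin

text \<open>
  Pairs of a cyclic permutation \<open>\<pi>\<close> and a \<open>++-\<close> segmentation of it are counted in two ways.

  For any sign pattern \<open>\<sigma>\<close>, labelling the orbit \<open>1, \<pi> 1, \<pi>\<^sup>2 1, \<dots>\<close> by the segments it visits gives
  a periodic word, and two orbit points compare as the words that start there, the comparison being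
  reversed by each common negative letter. A period \<open>d < n\<close> with an even number of negative letters
  would give an infinite increasing sequence of orbit points, so every proper period is odd. Hence
  the word is primitive, or of the form \<open>qq\<close> with \<open>q\<close> primitive and odd. Conversely each such
  necklace comes from exactly one pair: the point \<open>1\<close> is where its least rotation starts, and the
  word determines the order of the other points. So there are \<open>L\<^sup>*(n; \<sigma>)\<close> pairs.

  On the other hand, the cut between \<open>+\<close> and \<open>-\<close> can be made on either side of the peak, so the
  number of \<open>++-\<close> segmentations is twice the number of possible first cuts. If \<open>\<pi>\<close> is unimodal with
  peak at \<open>i\<close>, the first cuts are \<open>0, \<dots>, i\<close>. Otherwise there is at most one, since a \<open>\<pi>\<close> that rises
  up to the later of two first cuts and is unimodal after the earlier one is itself unimodal.
  So \<open>L\<^sup>*\<close> is \<open>2 (c\<^sub>5 + \<Sum>\<^sub>i i \<Lambda>(n, i))\<close>.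
\<close>

section \<open>Periodic words\<close>

definition periodic :: "nat \<Rightarrow> (nat \<Rightarrow> 'a) \<Rightarrow> bool" where
  "periodic n w \<longleftrightarrow> suffix n w = w"

lemma periodic_iff: "periodic n w \<longleftrightarrow> (\<forall>t. w (t + n) = w t)"
  by (auto simp: periodic_def fun_eq_iff add.commute)

lemma periodic_suffix: "periodic n w \<Longrightarrow> periodic n (suffix c w)"
  by (metis periodic_def suffix_suffix add.commute)

lemma periodic_mult: "periodic n w \<Longrightarrow> periodic (c * n) w"
proof (induction c)
  case (Suc c)
  then show ?case by (metis periodic_def suffix_suffix mult_Suc)
qed (simp add: periodic_def)

lemma periodic_diff: "periodic n w \<Longrightarrow> periodic d w \<Longrightarrow> d \<le> n \<Longrightarrow> periodic (n - d) w"
  by (metis periodic_def suffix_suffix le_add_diff_inverse)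

lemma periodic_mod:
  assumes "periodic n w"
  shows "w (t mod n) = w t"
  using periodic_mult[OF assms, of "t div n"] mod_div_mult_eq[of t n]
  by (metis periodic_iff)

lemma suffix_mod:
  assumes "periodic n w"
  shows "suffix (t mod n) w = suffix t w"
proof
  show "suffix (t mod n) w j = suffix t w j" for j
    using periodic_mod[OF periodic_suffix[OF assms, of j], of t] by (simp add: add.commute)
qed

lemma ex_suffix_inverse:
  assumes "periodic n w" "n > 0"
  obtains c' where "suffix c' (suffix c w) = w"
proof
  have "c \<le> c * n" using assms(2) by simp
  then show "suffix (c * n - c) (suffix c w) = w"
    using periodic_mult[OF assms(1), of c] by (simp add: periodic_def)
qed

lemma periodic_of_suffix_eq:
  assumes "periodic n w" "n > 0" "suffix t w = suffix (t + d) w"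
  shows "periodic d w"
proof -
  obtain t' where t': "suffix t' (suffix t w) = w" using ex_suffix_inverse[OF assms(1,2)] .
  have "suffix d w = suffix d (suffix t' (suffix t w))" by (simp only: t')
  also have "\<dots> = suffix t' (suffix (t + d) w)" by (simp add: ac_simps)
  also have "\<dots> = w" unfolding assms(3)[symmetric] by (rule t')
  finally show ?thesis by (simp add: periodic_def)
qed

section \<open>Ranks\<close>

definition rank :: "('a \<Rightarrow> 'b::linorder) \<Rightarrow> 'a set \<Rightarrow> 'a \<Rightarrow> nat" where
  "rank f A x = card {y \<in> A. f y \<le> f x}"

lemma rank_less_iff:
  assumes "finite A" "f y \<in> f ` A"
  shows "rank f A x < rank f A y \<longleftrightarrow> f x < f y"
proof
  assume less: "f x < f y"
  show "rank f A x < rank f A y"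
    unfolding rank_def
  proof (rule psubset_card_mono)
    obtain z where "z \<in> A" "f z = f y" using assms(2) by auto
    then have "z \<in> {z \<in> A. f z \<le> f y}" "z \<notin> {z \<in> A. f z \<le> f x}" using less by auto
    moreover have "{z \<in> A. f z \<le> f x} \<subseteq> {z \<in> A. f z \<le> f y}" using less by auto
    ultimately show "{z \<in> A. f z \<le> f x} \<subset> {z \<in> A. f z \<le> f y}" by blast
  qed (use assms(1) in simp)
next
  assume less: "rank f A x < rank f A y"
  show "f x < f y"
  proof (rule ccontr)
    assume "\<not> f x < f y"
    then have "rank f A y \<le> rank f A x"
      unfolding rank_def using assms(1) by (intro card_mono) auto
    then show False using less by simp
  qed
qed

lemma bij_betw_rank:
  assumes "finite A" "inj_on f A"
  shows "bij_betw (rank f A) A {1..card A}"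
proof -
  have "inj_on (rank f A) A"
  proof (rule inj_onI)
    fix x y assume xy: "x \<in> A" "y \<in> A" "rank f A x = rank f A y"
    then have "\<not> f x < f y" "\<not> f y < f x"
      using rank_less_iff[OF assms(1), of f] by (metis imageI order_less_irrefl)+
    then show "x = y" using inj_onD[OF assms(2) _ xy(1,2)] by simp
  qed
  moreover have "rank f A ` A \<subseteq> {1..card A}"
  proof safe
    fix x assume "x \<in> A"
    then have "{y \<in> A. f y \<le> f x} \<noteq> {}" by auto
    then show "rank f A x \<in> {1..card A}"
      unfolding rank_def using assms(1) by (auto simp: Suc_le_eq card_gt_0_iff intro: card_mono)
  qed
  ultimately show ?thesis
    by (metis bij_betw_def card_atLeastAtMost card_image card_subset_eq diff_Suc_1
        finite_atLeastAtMost)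
qed

lemma rank_bij_betw:
  assumes "bij_betw p A {1..n}" "x \<in> A"
  shows "rank p A x = p x"
proof -
  have inj: "inj_on p A" and im: "p ` A = {1..n}" using assms(1) by (auto simp: bij_betw_def)
  have "p x \<le> n" using im assms(2) by force
  have "p ` {y \<in> A. p y \<le> p x} = p ` A \<inter> {..p x}" by auto
  also have "\<dots> = {1..p x}" unfolding im using \<open>p x \<le> n\<close> by auto
  finally have "p ` {y \<in> A. p y \<le> p x} = {1..p x}" .
  moreover have "inj_on p {y \<in> A. p y \<le> p x}" using inj by (rule inj_on_subset) auto
  ultimately show ?thesis unfolding rank_def using card_image by fastforce
qed

section \<open>The signed order on words\<close>

definition signed_less :: "bool \<Rightarrow> 'a::ord \<Rightarrow> 'a \<Rightarrow> bool" where
  "signed_less s = (if s then (<) else (>))"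

lemma signed_less_simps [simp]: "signed_less True = (<)" "signed_less False = (>)"
  by (simp_all add: signed_less_def)

lemma o_sigma_simps [simp]:
  "o_sigma \<sigma> [] = 0"
  "o_sigma \<sigma> (c # s) = of_bool (c < length \<sigma> \<and> \<not> \<sigma> ! c) + o_sigma \<sigma> s"
  "o_sigma \<sigma> (s @ s') = o_sigma \<sigma> s + o_sigma \<sigma> s'"
  by (simp_all add: o_sigma_def)

lemma o_sigma_prefix_periodic:
  assumes "periodic d w"
  shows "o_sigma \<sigma> (prefix (d + t) w) = o_sigma \<sigma> (prefix d w) + o_sigma \<sigma> (prefix t w)"
proof -
  have "prefix (d + t) w = prefix d w @ prefix t (suffix d w)"
    by (simp add: subsequence_append)
  then show ?thesis using assms by (simp only: periodic_def o_sigma_simps)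
qed

text \<open>Negative letters complement the digits that follow them, so that the numerical order of the
  values is the lexicographic order of the words, reversed after each negative letter.\<close>

primrec signed_value :: "bool list \<Rightarrow> (nat \<Rightarrow> nat) \<Rightarrow> nat \<Rightarrow> nat \<Rightarrow> nat" where
  "signed_value \<sigma> w 0 t = 0"
| "signed_value \<sigma> w (Suc m) t = w t * length \<sigma> ^ m +
     (if \<sigma> ! w t then signed_value \<sigma> w m (Suc t)
      else length \<sigma> ^ m - 1 - signed_value \<sigma> w m (Suc t))"

lemma signed_value_bound:
  assumes "\<And>t. w t < length \<sigma>"
  shows "signed_value \<sigma> w m t < length \<sigma> ^ m"
proof (induction m arbitrary: t)
  case (Suc m)
  have "(if \<sigma> ! w t then signed_value \<sigma> w m (Suc t)
      else length \<sigma> ^ m - 1 - signed_value \<sigma> w m (Suc t)) < length \<sigma> ^ m"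
    using Suc.IH[of "Suc t"] by (auto simp: less_imp_diff_less)
  moreover have "(w t + 1) * length \<sigma> ^ m \<le> length \<sigma> * length \<sigma> ^ m"
    using assms[of t] by (intro mult_right_mono) auto
  ultimately show ?case by (simp add: algebra_simps)
qed simp

lemma leading_digit_less_iff:
  fixes a b x y c :: nat
  assumes "x < c" "y < c"
  shows "a * c + x < b * c + y \<longleftrightarrow> a < b \<or> a = b \<and> x < y"
proof -
  have "a' * c + x' < b' * c + y'" if "a' < b'" "x' < c" for a' b' x' y'
  proof -
    have "a' * c + x' < Suc a' * c" using that(2) by simp
    also have "\<dots> \<le> b' * c + y'" using mult_le_mono1[of "Suc a'" b' c] that(1) by simp
    finally show ?thesis .
  qed
  from this[of a b x y] this[of b a y x] show ?thesis
    using assms by (cases a b rule: linorder_cases) auto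
qed

lemma signed_value_Suc_less_iff:
  assumes "\<And>t. w t < length \<sigma>"
  shows "signed_value \<sigma> w (Suc m) t < signed_value \<sigma> w (Suc m) u \<longleftrightarrow>
    w t < w u \<or> w t = w u \<and>
      signed_less (\<sigma> ! w t) (signed_value \<sigma> w m (Suc t)) (signed_value \<sigma> w m (Suc u))"
proof -
  define digits where "digits t = (if \<sigma> ! w t then signed_value \<sigma> w m (Suc t)
    else length \<sigma> ^ m - 1 - signed_value \<sigma> w m (Suc t))" for t
  have bound: "signed_value \<sigma> w m v < length \<sigma> ^ m" for v
    by (rule signed_value_bound[OF assms])
  have "digits v < length \<sigma> ^ m" for v
    using bound[of "Suc v"] by (auto simp: digits_def)
  moreover have "signed_value \<sigma> w (Suc m) v = w v * length \<sigma> ^ m + digits v" for v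
    by (simp add: digits_def)
  moreover have "digits t < digits u \<longleftrightarrow>
      signed_less (\<sigma> ! w t) (signed_value \<sigma> w m (Suc t)) (signed_value \<sigma> w m (Suc u))"
    if "w t = w u"
    using bound[of "Suc t"] bound[of "Suc u"] that by (cases "\<sigma> ! w t") (auto simp: digits_def)
  ultimately show ?thesis using leading_digit_less_iff by auto
qed

lemma signed_value_eq_iff:
  assumes "\<And>t. w t < length \<sigma>"
  shows "signed_value \<sigma> w m t = signed_value \<sigma> w m u \<longleftrightarrow> (\<forall>j<m. w (t + j) = w (u + j))"
proof (induction m arbitrary: t u)
  case (Suc m)
  have "signed_value \<sigma> w (Suc m) t = signed_value \<sigma> w (Suc m) u \<longleftrightarrow>
      w t = w u \<and> signed_value \<sigma> w m (Suc t) = signed_value \<sigma> w m (Suc u)"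
    unfolding order_eq_iff[of "signed_value _ _ (Suc m) _"] linorder_not_less[symmetric]
      signed_value_Suc_less_iff[OF assms]
    by (cases "\<sigma> ! w t"; cases "w t = w u") auto
  also have "\<dots> \<longleftrightarrow> (\<forall>j<Suc m. w (t + j) = w (u + j))"
    unfolding Suc.IH by (auto simp: less_Suc_eq_0_disj)
  finally show ?case .
qed simp

lemma signed_value_eq_iff_suffix_eq:
  assumes "\<And>t. w t < length \<sigma>" "periodic n w" "n > 0"
  shows "signed_value \<sigma> w n t = signed_value \<sigma> w n u \<longleftrightarrow> suffix t w = suffix u w"
proof
  assume "signed_value \<sigma> w n t = signed_value \<sigma> w n u"
  then have "suffix t w (j mod n) = suffix u w (j mod n)" for j
    unfolding signed_value_eq_iff[of w, OF assms(1)] using assms(3) by simp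
  then show "suffix t w = suffix u w"
    unfolding periodic_mod[OF periodic_suffix[OF assms(2)]] by (rule ext)
qed (simp add: signed_value_eq_iff[of w, OF assms(1)] fun_eq_iff)

lemma signed_value_less_Suc:
  assumes "\<And>t. w t < length \<sigma>" "signed_value \<sigma> w m t < signed_value \<sigma> w m u"
  shows "signed_value \<sigma> w (Suc m) t < signed_value \<sigma> w (Suc m) u"
  using assms(2)
proof (induction m arbitrary: t u)
  case (Suc m)
  have "signed_less s (signed_value \<sigma> w (Suc m) (Suc t)) (signed_value \<sigma> w (Suc m) (Suc u))"
    if "signed_less s (signed_value \<sigma> w m (Suc t)) (signed_value \<sigma> w m (Suc u))" for s
    using that Suc.IH by (cases s) simp_all
  then show ?case
    using Suc.prems unfolding signed_value_Suc_less_iff[of w, OF assms(1)] by blast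
qed simp

lemma signed_value_suffix: "signed_value \<sigma> (suffix c w) m t = signed_value \<sigma> w m (c + t)"
  by (induction m arbitrary: t) simp_all

section \<open>Admissible words\<close>

definition admissible :: "bool list \<Rightarrow> nat \<Rightarrow> (nat \<Rightarrow> nat) \<Rightarrow> bool" where
  "admissible \<sigma> n w \<longleftrightarrow> (\<forall>t. w t < length \<sigma>) \<and> periodic n w \<and>
     (\<forall>d. 0 < d \<and> d < n \<and> periodic d w \<longrightarrow> odd (o_sigma \<sigma> (prefix d w)))"

lemma admissible_letter_less: "admissible \<sigma> n w \<Longrightarrow> w t < length \<sigma>"
  by (simp add: admissible_def)

lemma admissible_periodic: "admissible \<sigma> n w \<Longrightarrow> periodic n w"
  by (simp add: admissible_def)

lemma admissible_odd:
  "admissible \<sigma> n w \<Longrightarrow> 0 < d \<Longrightarrow> d < n \<Longrightarrow> periodic d w \<Longrightarrow> odd (o_sigma \<sigma> (prefix d w))"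
  by (simp add: admissible_def)

lemma admissible_period:
  assumes "admissible \<sigma> n w" "0 < d" "d < n" "periodic d w"
  shows "n = 2 * d"
proof -
  have not_less: "\<not> 2 * c < n" if "0 < c" "periodic c w" for c
  proof
    assume "2 * c < n"
    then have "odd (o_sigma \<sigma> (prefix (c + c) w))"
      using admissible_odd[OF assms(1), of "c + c"] periodic_mult[OF that(2), of 2] that(1)
      by (simp add: mult_2)
    then show False by (simp add: o_sigma_prefix_periodic[OF that(2)])
  qed
  have "periodic (n - d) w"
    using admissible_periodic[OF assms(1)] assms(3,4) by (intro periodic_diff) auto
  then show ?thesis using not_less[of "n - d"] not_less[of d] assms by simp
qed

lemma admissible_suffix_eq:
  assumes "admissible \<sigma> n w" "t < n" "u < n" "t \<noteq> u" "suffix t w = suffix u w"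
  shows "even (o_sigma \<sigma> (prefix n w)) \<and>
    (even (o_sigma \<sigma> (prefix t w)) \<longleftrightarrow> odd (o_sigma \<sigma> (prefix u w)))"
  using assms(2-5)
proof (induction t u rule: linorder_wlog)
  case (le t u)
  define d where "d = u - t"
  have d: "0 < d" "d < n" "u = d + t" using le by (auto simp: d_def)
  have "suffix t w = suffix (t + d) w" using le by (simp only: d_def le_add_diff_inverse)
  then have per: "periodic d w"
    using periodic_of_suffix_eq[OF admissible_periodic[OF assms(1)]] le(3) by auto
  have "odd (o_sigma \<sigma> (prefix d w))" by (rule admissible_odd[OF assms(1) d(1,2) per])
  moreover have "n = d + d" using admissible_period[OF assms(1) d(1,2) per] by simp
  ultimately show ?case by (simp add: d(3) o_sigma_prefix_periodic[OF per])
qed metis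

lemma admissible_signed_value_eq:
  assumes "admissible \<sigma> n w" "n > 0" "t mod n \<noteq> u mod n"
    and "signed_value \<sigma> w n t = signed_value \<sigma> w n u"
  shows "suffix t w = suffix u w" "even (o_sigma \<sigma> (prefix n w))"
    "even (o_sigma \<sigma> (prefix (t mod n) w)) \<longleftrightarrow> odd (o_sigma \<sigma> (prefix (u mod n) w))"
proof -
  note per = admissible_periodic[OF assms(1)]
  note letter = admissible_letter_less[OF assms(1)]
  show "suffix t w = suffix u w"
    using assms(4) signed_value_eq_iff_suffix_eq[of w, OF letter per assms(2)] by blast
  then have "suffix (t mod n) w = suffix (u mod n) w" by (simp only: suffix_mod[OF per])
  then show "even (o_sigma \<sigma> (prefix n w))"
    "even (o_sigma \<sigma> (prefix (t mod n) w)) \<longleftrightarrow> odd (o_sigma \<sigma> (prefix (u mod n) w))"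
    using admissible_suffix_eq[OF assms(1), of "t mod n" "u mod n"] assms(2,3) by simp_all
qed

text \<open>Ties of the signed order are broken by the parity of the number of negative letters read so
  far, which changes along a step exactly when the step reverses the order.\<close>

definition orbit_key :: "bool list \<Rightarrow> nat \<Rightarrow> (nat \<Rightarrow> nat) \<Rightarrow> nat \<Rightarrow> nat" where
  "orbit_key \<sigma> n w t = 2 * signed_value \<sigma> w n t + o_sigma \<sigma> (prefix (t mod n) w) mod 2"

lemma orbit_key_less_iff:
  "orbit_key \<sigma> n w t < orbit_key \<sigma> n w u \<longleftrightarrow>
    signed_value \<sigma> w n t < signed_value \<sigma> w n u \<or>
    signed_value \<sigma> w n t = signed_value \<sigma> w n u \<and>
      even (o_sigma \<sigma> (prefix (t mod n) w)) \<and> odd (o_sigma \<sigma> (prefix (u mod n) w))"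
  unfolding orbit_key_def even_iff_mod_2_eq_zero odd_iff_mod_2_eq_one by linarith

lemma periodic_orbit_key:
  assumes "periodic n w"
  shows "periodic n (orbit_key \<sigma> n w)"
proof -
  have "signed_value \<sigma> w n (t + n) = signed_value \<sigma> w n t" for t
    using signed_value_suffix[of \<sigma> n w n t] assms by (simp add: periodic_def add.commute)
  then show ?thesis by (simp add: periodic_iff orbit_key_def)
qed

lemma inj_on_orbit_key:
  assumes "admissible \<sigma> n w"
  shows "inj_on (orbit_key \<sigma> n w) {..<n}"
proof (rule inj_onI, rule ccontr)
  fix t u assume tu: "t \<in> {..<n}" "u \<in> {..<n}" "orbit_key \<sigma> n w t = orbit_key \<sigma> n w u" "t \<noteq> u"
  then have "signed_value \<sigma> w n t = signed_value \<sigma> w n u"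
    and "even (o_sigma \<sigma> (prefix t w)) \<longleftrightarrow> even (o_sigma \<sigma> (prefix u w))"
    using orbit_key_less_iff[of \<sigma> n w t u] orbit_key_less_iff[of \<sigma> n w u t]
    by (auto simp: linorder_neq_iff[of "signed_value _ _ _ t"] orbit_key_def)
  then show False using admissible_signed_value_eq(3)[OF assms, of t u] tu by simp
qed

lemma orbit_key_step_of_signed_value_less:
  assumes "admissible \<sigma> n w" "w t = w u" "signed_value \<sigma> w n t < signed_value \<sigma> w n u"
  shows "signed_less (\<sigma> ! w t) (orbit_key \<sigma> n w (Suc t)) (orbit_key \<sigma> n w (Suc u))"
proof -
  note letter = admissible_letter_less[OF assms(1)]
  obtain m where m: "n = Suc m" using assms(3) by (cases n) auto
  have "signed_less (\<sigma> ! w t) (signed_value \<sigma> w m (Suc t)) (signed_value \<sigma> w m (Suc u))"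
    using assms(2,3) unfolding m signed_value_Suc_less_iff[of w, OF letter] by auto
  then have "signed_less (\<sigma> ! w t) (signed_value \<sigma> w n (Suc t)) (signed_value \<sigma> w n (Suc u))"
    unfolding m using signed_value_less_Suc[of w, OF letter] by (cases "\<sigma> ! w t") auto
  then show ?thesis by (cases "\<sigma> ! w t") (auto simp: orbit_key_less_iff)
qed

lemma orbit_key_step:
  assumes "admissible \<sigma> n w" "n > 0" "w t = w u" "orbit_key \<sigma> n w t < orbit_key \<sigma> n w u"
  shows "signed_less (\<sigma> ! w t) (orbit_key \<sigma> n w (Suc t)) (orbit_key \<sigma> n w (Suc u))"
proof (cases "signed_value \<sigma> w n t < signed_value \<sigma> w n u")
  case True
  then show ?thesis by (rule orbit_key_step_of_signed_value_less[OF assms(1,3)])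
next
  case False
  then have value_eq: "signed_value \<sigma> w n t = signed_value \<sigma> w n u"
    using assms(4) by (auto simp: orbit_key_less_iff)
  note letter = admissible_letter_less[OF assms(1)] and per = admissible_periodic[OF assms(1)]
  have "t mod n \<noteq> u mod n" using assms(4) value_eq by (auto simp: orbit_key_def)
  note tie = admissible_signed_value_eq[OF assms(1,2) this value_eq]
  have parity: "even (o_sigma \<sigma> (prefix (Suc v mod n) w)) \<longleftrightarrow>
      even (o_sigma \<sigma> (prefix (v mod n) w)) = \<sigma> ! w v" for v
    using tie(2) letter[of v] periodic_mod[OF per, of v] subseq_to_Suc[of 0 "v mod n" w]
    by (cases "Suc (v mod n) = n") (auto simp: mod_Suc)
  have "signed_value \<sigma> w n (Suc t) = signed_value \<sigma> w n (Suc u)"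
    using signed_value_eq_iff_suffix_eq[of w, OF letter per assms(2)]
      arg_cong[OF tie(1), of "suffix 1"] by simp
  then show ?thesis
    using assms(3,4) value_eq by (cases "\<sigma> ! w t") (simp_all add: orbit_key_less_iff parity)
qed

definition orbit_of_word :: "bool list \<Rightarrow> nat \<Rightarrow> (nat \<Rightarrow> nat) \<Rightarrow> nat \<Rightarrow> nat" where
  "orbit_of_word \<sigma> n w = rank (orbit_key \<sigma> n w) {..<n}"

lemma orbit_of_word_less_iff:
  assumes "periodic n w" "n > 0"
  shows "orbit_of_word \<sigma> n w t < orbit_of_word \<sigma> n w u \<longleftrightarrow> orbit_key \<sigma> n w t < orbit_key \<sigma> n w u"
  unfolding orbit_of_word_def
proof (rule rank_less_iff)
  show "orbit_key \<sigma> n w u \<in> orbit_key \<sigma> n w ` {..<n}"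
    using periodic_mod[OF periodic_orbit_key[OF assms(1)], of \<sigma> u] assms(2)
    by (metis imageI lessThan_iff mod_less_divisor)
qed simp

section \<open>Signed orbits\<close>

locale cyclic_sequence =
  fixes n :: nat and p :: "nat \<Rightarrow> nat"
  assumes pos: "n > 0"
    and periodic_point: "periodic n p"
    and bij: "bij_betw p {..<n} {1..n}"
begin

lemma point_mod: "p (t mod n) = p t"
  by (rule periodic_mod[OF periodic_point])

lemma point_range: "p t \<in> {1..n}"
  using bij_betwE[OF bij] pos point_mod[of t] by (metis lessThan_iff mod_less_divisor)

lemma ex_point: "x \<in> {1..n} \<Longrightarrow> \<exists>t. p t = x"
  using bij unfolding bij_betw_def by (metis imageE)

lemma point_eq_iff: "p t = p u \<longleftrightarrow> t mod n = u mod n"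
proof -
  have "p (t mod n) = p (u mod n) \<longleftrightarrow> t mod n = u mod n"
    using bij pos by (auto simp: bij_betw_def inj_on_def)
  then show ?thesis by (simp add: point_mod)
qed

lemma point_Suc_eq: "p t = p u \<Longrightarrow> p (Suc t) = p (Suc u)"
  unfolding point_eq_iff by (metis mod_Suc_eq)

lemma cyclic_sequence_suffix: "cyclic_sequence n (suffix c p)"
proof
  obtain c' where c': "suffix c' (suffix c p) = p"
    using ex_suffix_inverse[OF periodic_point pos] .
  have "{1..n} \<subseteq> suffix c p ` {..<n}"
  proof
    fix x assume "x \<in> {1..n}"
    then obtain t where t: "p t = x" using ex_point by blast
    have "x = suffix c p (c' + t)" using fun_cong[OF c', of t] t by (simp add: add.assoc)
    also have "\<dots> = suffix c p ((c' + t) mod n)"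
      by (rule periodic_mod[OF periodic_suffix[OF periodic_point], symmetric])
    finally show "x \<in> suffix c p ` {..<n}" using pos by simp
  qed
  then have "suffix c p ` {..<n} = {1..n}" using point_range by auto
  then show "bij_betw (suffix c p) {..<n} {1..n}" by (simp add: bij_betw_def eq_card_imp_inj_on)
qed (use pos periodic_suffix[OF periodic_point] in auto)

end

text \<open>\<open>p\<close> is the orbit of a cyclic permutation of \<open>[n]\<close>, and \<open>w t\<close> is the number of the segment
  containing \<open>p t\<close>.\<close>

locale signed_orbit = cyclic_sequence n p for n p +
  fixes \<sigma> :: "bool list" and w :: "nat \<Rightarrow> nat"
  assumes letter_less: "w t < length \<sigma>"
    and letter_mono: "p t \<le> p u \<Longrightarrow> w t \<le> w u"
    and step: "w t = w u \<Longrightarrow> p t < p u \<Longrightarrow> signed_less (\<sigma> ! w t) (p (Suc t)) (p (Suc u))"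
begin

lemma letter_eq: "p t = p u \<Longrightarrow> w t = w u"
  by (intro order_antisym letter_mono) simp_all

lemma periodic_letter: "periodic n w"
  using periodic_point unfolding periodic_iff by (intro allI letter_eq) simp

lemma signed_less_step_iff:
  assumes "w t = w u"
  shows "signed_less s (p (Suc t)) (p (Suc u)) \<longleftrightarrow> signed_less (s = \<sigma> ! w t) (p t) (p u)"
  using point_Suc_eq[of t u] step[OF assms] step[OF assms[symmetric]] assms
  by (cases "p t" "p u" rule: linorder_cases; cases s; cases "\<sigma> ! w t") auto

lemma signed_less_steps_iff:
  assumes "\<And>j. j < m \<Longrightarrow> w (t + j) = w (u + j)"
  shows "signed_less s (p (t + m)) (p (u + m)) \<longleftrightarrow>
    signed_less (s = (even (o_sigma \<sigma> (prefix t w)) = even (o_sigma \<sigma> (prefix (t + m) w))))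
      (p t) (p u)"
  using assms
proof (induction m arbitrary: s)
  case (Suc m)
  then show ?case
    using signed_less_step_iff[of "t + m" "u + m" s] letter_less[of "t + m"]
    by (cases s; cases "\<sigma> ! w (t + m)") simp_all
qed simp

lemma point_less_of_signed_value_less:
  "signed_value \<sigma> w m t < signed_value \<sigma> w m u \<Longrightarrow> p t < p u"
proof (induction m arbitrary: t u)
  case (Suc m)
  then consider "w t < w u"
    | "w t = w u" "signed_less (\<sigma> ! w t) (signed_value \<sigma> w m (Suc t)) (signed_value \<sigma> w m (Suc u))"
    unfolding signed_value_Suc_less_iff[of w, OF letter_less] by blast
  then show ?case
  proof cases
    case 1
    then show ?thesis using letter_mono[of u t] by (meson not_le)
  next
    case 2
    then have "signed_less (\<sigma> ! w t) (p (Suc t)) (p (Suc u))"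
      using Suc.IH by (cases "\<sigma> ! w t") auto
    then show ?thesis using signed_less_step_iff[OF 2(1)] by simp
  qed
qed simp

lemma admissible: "admissible \<sigma> n w"
  unfolding admissible_def
proof (intro conjI allI impI)
  fix d assume d: "0 < d \<and> d < n \<and> periodic d w"
  show "odd (o_sigma \<sigma> (prefix d w))"
  proof
    assume even: "even (o_sigma \<sigma> (prefix d w))"
    have shift: "p (t + d) < p (t + d + d) \<longleftrightarrow> p t < p (t + d)" for t
    proof -
      have "w (t + j) = w (t + d + j)" for j
        using d by (metis periodic_iff add.assoc add.commute)
      moreover have "even (o_sigma \<sigma> (prefix t w)) = even (o_sigma \<sigma> (prefix (t + d) w))"
        using o_sigma_prefix_periodic[of d w \<sigma> t] d even by (simp add: add.commute)
      ultimately show ?thesis using signed_less_steps_iff[of d t "t + d" True] by simp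
    qed
    obtain c where c: "p c = 1" using ex_point[of 1] pos by auto
    have "p c \<noteq> p (c + d)"
      using d nat_dvd_not_less[of d n] mod_eq_dvd_iff_nat[of c "c + d" n]
      by (auto simp: point_eq_iff)
    then have start: "p c < p (c + d)" using point_range[of "c + d"] c by simp
    have incr: "p (c + j * d) < p (c + Suc j * d)" for j
    proof (induction j)
      case (Suc j)
      then show ?case using shift[of "c + j * d"] by (simp add: ac_simps)
    qed (use start in simp)
    have "strict_mono (\<lambda>j. p (c + j * d))" using incr by (simp add: strict_mono_Suc_iff)
    then have "p (c + 0 * d) < p (c + n * d)" using pos by (rule strict_monoD)
    moreover have "p (c + n * d) = p c" by (simp add: point_eq_iff)
    ultimately show False by simp
  qed
qed (use letter_less periodic_letter in auto)

lemma suffix: "signed_orbit n (suffix c p) \<sigma> (suffix c w)"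
proof -
  interpret suffix: cyclic_sequence n "suffix c p" by (rule cyclic_sequence_suffix)
  show ?thesis by unfold_locales (use letter_less letter_mono step in auto)
qed

lemma point_less_iff_key_less:
  assumes "p 0 = 1"
  shows "p t < p u \<longleftrightarrow> orbit_key \<sigma> n w t < orbit_key \<sigma> n w u"
proof -
  have less: "p t < p u"
    if "t < n" "u < n" and key: "orbit_key \<sigma> n w t < orbit_key \<sigma> n w u" for t u
  proof (cases "signed_value \<sigma> w n t < signed_value \<sigma> w n u")
    case True
    then show ?thesis by (rule point_less_of_signed_value_less)
  next
    case False
    with key have value_eq: "signed_value \<sigma> w n t = signed_value \<sigma> w n u"
      and even: "even (o_sigma \<sigma> (prefix t w))"
      using \<open>t < n\<close> by (auto simp: orbit_key_less_iff)
    have neq: "t mod n \<noteq> u mod n" using key \<open>t < n\<close> \<open>u < n\<close> by auto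
    note tie = admissible_signed_value_eq[OF admissible pos neq value_eq]
    have "w (t + j) = w (u + j)" for j using fun_cong[OF tie(1), of j] by simp
    then have "p (t + (n - t)) > p (u + (n - t)) \<longleftrightarrow> p t > p u"
      using signed_less_steps_iff[of "n - t" t u False] even tie(2) \<open>t < n\<close> by simp
    moreover have "p (t + (n - t)) = 1" using \<open>t < n\<close> point_mod[of n] assms by simp
    ultimately have "p t \<le> p u" using point_range[of "u + (n - t)"] by auto
    then show ?thesis using neq point_eq_iff[of t u] by simp
  qed
  have "p (t mod n) < p (u mod n) \<longleftrightarrow> orbit_key \<sigma> n w (t mod n) < orbit_key \<sigma> n w (u mod n)"
    using less[of "t mod n" "u mod n"] less[of "u mod n" "t mod n"] pos
      inj_onD[OF inj_on_orbit_key[OF admissible], of "t mod n" "u mod n"]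
    by (cases "orbit_key \<sigma> n w (t mod n)" "orbit_key \<sigma> n w (u mod n)" rule: linorder_cases) auto
  then show ?thesis
    by (simp only: point_mod periodic_mod[OF periodic_orbit_key[OF periodic_letter]])
qed

lemma point_eq_orbit_of_word:
  assumes "p 0 = 1"
  shows "p = orbit_of_word \<sigma> n w"
proof
  fix t
  have "p t = rank p {..<n} (t mod n)"
    using rank_bij_betw[OF bij] pos by (simp add: point_mod)
  also have "\<dots> = rank (orbit_key \<sigma> n w) {..<n} (t mod n)"
    by (simp add: rank_def point_less_iff_key_less[OF assms] flip: not_less)
  also have "\<dots> = rank (orbit_key \<sigma> n w) {..<n} t"
    by (simp add: rank_def periodic_mod[OF periodic_orbit_key[OF periodic_letter]])
  finally show "p t = orbit_of_word \<sigma> n w t" by (simp only: orbit_of_word_def)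
qed

lemma signed_value_min:
  assumes "p 0 = 1"
  shows "signed_value \<sigma> w n 0 \<le> signed_value \<sigma> w n t"
proof (rule ccontr)
  assume "\<not> signed_value \<sigma> w n 0 \<le> signed_value \<sigma> w n t"
  then have "p t < p 0" by (intro point_less_of_signed_value_less[of n t 0]) simp
  then show False using assms point_range[of t] by simp
qed

end

lemma suffix_eq_of_signed_orbits_from_1:
  assumes "signed_orbit n p \<sigma> w" "p 0 = 1" "signed_orbit n p' \<sigma> (suffix c w)" "p' 0 = 1"
  shows "suffix c w = w"
proof -
  interpret signed_orbit n p \<sigma> w by (rule assms(1))
  obtain c' where c': "suffix c' (suffix c w) = w"
    using ex_suffix_inverse[OF periodic_letter pos] .
  have "signed_value \<sigma> w n c \<le> signed_value \<sigma> (suffix c' (suffix c w)) n 0"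
    using signed_orbit.signed_value_min[OF assms(3,4), of c'] by (simp add: signed_value_suffix)
  then have "signed_value \<sigma> w n c = signed_value \<sigma> w n 0"
    unfolding c' using signed_value_min[OF assms(2), of c] by simp
  then show ?thesis
    using signed_value_eq_iff_suffix_eq[of w, OF letter_less periodic_letter pos, of c 0] by simp
qed

lemma signed_orbit_orbit_of_word:
  assumes "admissible \<sigma> n w" "n > 0"
  shows "signed_orbit n (orbit_of_word \<sigma> n w) \<sigma> w"
proof
  note letter = admissible_letter_less[OF assms(1)] and per = admissible_periodic[OF assms(1)]
  note less_iff = orbit_of_word_less_iff[OF per assms(2), of \<sigma>]
  show "n > 0" "w t < length \<sigma>" for t using assms(2) letter by simp_all
  show "periodic n (orbit_of_word \<sigma> n w)"
    using periodic_orbit_key[OF per] by (simp add: periodic_iff rank_def orbit_of_word_def)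
  show "bij_betw (orbit_of_word \<sigma> n w) {..<n} {1..n}"
    using bij_betw_rank[OF _ inj_on_orbit_key[OF assms(1)]] by (simp add: orbit_of_word_def)
  show "w t \<le> w u" if "orbit_of_word \<sigma> n w t \<le> orbit_of_word \<sigma> n w u" for t u
  proof -
    obtain m where m: "n = Suc m" using assms(2) by (cases n) auto
    have "\<not> orbit_key \<sigma> n w u < orbit_key \<sigma> n w t"
      using that unfolding less_iff[symmetric] by simp
    then have "\<not> signed_value \<sigma> w (Suc m) u < signed_value \<sigma> w (Suc m) t"
      unfolding orbit_key_less_iff m by blast
    then show ?thesis unfolding signed_value_Suc_less_iff[of w, OF letter] by auto
  qed
  show "signed_less (\<sigma> ! w t) (orbit_of_word \<sigma> n w (Suc t)) (orbit_of_word \<sigma> n w (Suc u))"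
    if "w t = w u" "orbit_of_word \<sigma> n w t < orbit_of_word \<sigma> n w u" for t u
    using orbit_key_step[OF assms that(1)] that(2) less_iff by (cases "\<sigma> ! w t") simp_all
qed

lemma ex_signed_orbit_from_1:
  assumes "admissible \<sigma> n w" "n > 0"
  obtains p c where "signed_orbit n p \<sigma> (suffix c w)" "p 0 = 1"
proof -
  interpret signed_orbit n "orbit_of_word \<sigma> n w" \<sigma> w
    by (rule signed_orbit_orbit_of_word[OF assms])
  obtain c where "orbit_of_word \<sigma> n w c = 1" using ex_point[of 1] assms(2) by auto
  then show ?thesis using that[OF suffix[of c]] by simp
qed

section \<open>Admissible necklaces\<close>

lemma suffix_iter: "s \<noteq> [] \<Longrightarrow> suffix j s\<^sup>\<omega> = (rotate j s)\<^sup>\<omega>"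
  by (rule ext) (simp add: nth_rotate mod_add_right_eq)

lemma periodic_iter: "s \<noteq> [] \<Longrightarrow> periodic (length s) s\<^sup>\<omega>"
  by (simp add: periodic_iff)

lemma prefix_iter: "s \<noteq> [] \<Longrightarrow> prefix (length s) s\<^sup>\<omega> = s"
  by (subst iter_unroll) simp_all

lemma iter_inject: "s \<noteq> [] \<Longrightarrow> length s = length s' \<Longrightarrow> s\<^sup>\<omega> = s'\<^sup>\<omega> \<Longrightarrow> s = s'"
  by (metis prefix_iter length_0_conv)

lemma iter_prefix: "periodic n w \<Longrightarrow> n > 0 \<Longrightarrow> (prefix n w)\<^sup>\<omega> = w"
  by (rule ext) (simp add: periodic_mod)

lemma concat_replicate_eq_prefix_iter:
  assumes "q \<noteq> []"
  shows "concat (replicate r q) = prefix (r * length q) q\<^sup>\<omega>"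
proof (induction r)
  case (Suc r)
  have "prefix (Suc r * length q) q\<^sup>\<omega> =
      prefix (length q) q\<^sup>\<omega> @ prefix (r * length q) (suffix (length q) q\<^sup>\<omega>)"
    by (simp add: subsequence_append)
  then show ?case
    using Suc.IH prefix_iter[OF assms] periodic_iter[OF assms] by (simp only: periodic_def) simp
qed simp

lemma iter_concat_replicate:
  assumes "q \<noteq> []" "r > 0"
  shows "(concat (replicate r q))\<^sup>\<omega> = q\<^sup>\<omega>"
  unfolding concat_replicate_eq_prefix_iter[OF assms(1)]
  using assms by (intro iter_prefix periodic_mult periodic_iter) auto

lemma primitive_iff_not_periodic:
  assumes "s \<noteq> []"
  shows "primitive s \<longleftrightarrow> (\<forall>d. 0 < d \<and> d < length s \<longrightarrow> \<not> periodic d s\<^sup>\<omega>)"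
proof
  show "\<forall>d. 0 < d \<and> d < length s \<longrightarrow> \<not> periodic d s\<^sup>\<omega>" if "primitive s"
  proof (intro allI impI notI)
    fix d assume d: "0 < d \<and> d < length s" and "periodic d s\<^sup>\<omega>"
    then have "(rotate d s)\<^sup>\<omega> = s\<^sup>\<omega>" using assms by (simp add: periodic_def flip: suffix_iter)
    then have "rotate d s = s" using assms by (intro iter_inject) auto
    then have "take d s @ drop d s = drop d s @ take d s"
      using d by (simp add: rotate_drop_take)
    then obtain a b q
      where q: "concat (replicate a q) = take d s" "concat (replicate b q) = drop d s"
      using comm_append_are_replicate by blast
    then have "s = concat (replicate (a + b) q)" by (simp add: replicate_add)
    moreover have "a > 0" "b > 0" using q d by (auto intro!: gr0I)
    then have "a + b > 1" by simp
    ultimately show False using that unfolding primitive_def by blast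
  qed
  show "primitive s" if "\<forall>d. 0 < d \<and> d < length s \<longrightarrow> \<not> periodic d s\<^sup>\<omega>"
    unfolding primitive_def
  proof (intro notI, elim exE conjE)
    fix q r assume r: "r > 1" "s = concat (replicate r q)"
    then have "q \<noteq> []" "length s = r * length q"
      using assms by (auto simp: length_concat sum_list_replicate)
    moreover from this have "periodic (length q) s\<^sup>\<omega>"
      using r periodic_iter by (simp add: iter_concat_replicate)
    ultimately show False using that r(1) by simp
  qed
qed

lemma iter_append_self: "q \<noteq> [] \<Longrightarrow> (q @ q)\<^sup>\<omega> = q\<^sup>\<omega>"
  using iter_concat_replicate[of q 2] by (simp add: numeral_2_eq_2)

lemma admissible_iter_iff_periods:
  assumes "s \<in> words (length \<sigma>) n" "n > 0"
  shows "admissible \<sigma> n s\<^sup>\<omega> \<longleftrightarrow>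
    (\<forall>d. 0 < d \<and> d < n \<and> periodic d s\<^sup>\<omega> \<longrightarrow> odd (o_sigma \<sigma> (prefix d s\<^sup>\<omega>)))"
proof -
  have len: "length s = n" and set: "set s \<subseteq> {0..<length \<sigma>}" and "s \<noteq> []"
    using assms by (auto simp: words_def)
  have "s\<^sup>\<omega> t \<in> set s" for t using assms(2) len by simp
  then have "s\<^sup>\<omega> t < length \<sigma>" for t using set by fastforce
  moreover have "periodic n s\<^sup>\<omega>" using periodic_iter[OF \<open>s \<noteq> []\<close>] len by simp
  ultimately show ?thesis by (simp add: admissible_def)
qed

lemma admissible_iter_append_self:
  assumes "q @ q \<in> words (length \<sigma>) n" "n > 0" "primitive q" "odd (o_sigma \<sigma> q)"
  shows "admissible \<sigma> n (q @ q)\<^sup>\<omega>"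
  unfolding admissible_iter_iff_periods[OF assms(1,2)]
proof (intro allI impI)
  fix d assume d: "0 < d \<and> d < n \<and> periodic d (q @ q)\<^sup>\<omega>"
  have n: "n = 2 * length q" and "q \<noteq> []" using assms(1,2) by (auto simp: words_def)
  note iter = iter_append_self[OF \<open>q \<noteq> []\<close>]
  have "\<not> (0 < c \<and> c < length q \<and> periodic c q\<^sup>\<omega>)" for c
    using primitive_iff_not_periodic[OF \<open>q \<noteq> []\<close>] assms(3) by blast
  note no_period = this[of d] this[of "d - length q"]
  have "periodic d q\<^sup>\<omega>" using d iter by simp
  moreover from this have "length q \<le> d \<Longrightarrow> periodic (d - length q) q\<^sup>\<omega>"
    by (rule periodic_diff[OF _ periodic_iter[OF \<open>q \<noteq> []\<close>]])
  ultimately have "d = length q"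
    using no_period d n by (cases "length q" d rule: linorder_cases) auto
  then show "odd (o_sigma \<sigma> (prefix d (q @ q)\<^sup>\<omega>))"
    using assms(4) iter prefix_iter[OF \<open>q \<noteq> []\<close>] by simp
qed

lemma admissible_iter_not_primitive:
  assumes "s \<noteq> []" "admissible \<sigma> (length s) s\<^sup>\<omega>" "\<not> primitive s"
  obtains q where "s = q @ q" "primitive q" "odd (o_sigma \<sigma> q)"
proof -
  obtain d where d: "0 < d" "d < length s" "periodic d s\<^sup>\<omega>"
    using assms(3) primitive_iff_not_periodic[OF assms(1)] by blast
  note half = admissible_period[OF assms(2)]
  define q where "q = prefix d s\<^sup>\<omega>"
  have q: "length q = d" "q \<noteq> []" "q\<^sup>\<omega> = s\<^sup>\<omega>" using d iter_prefix by (auto simp: q_def)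
  have "s = prefix (d + d) s\<^sup>\<omega>"
    using half[OF d] prefix_iter[OF assms(1)] by (simp add: mult_2)
  also have "\<dots> = q @ prefix d (suffix d s\<^sup>\<omega>)" by (simp add: subsequence_append q_def)
  also have "\<dots> = q @ q" using d(3) by (simp only: periodic_def q_def)
  finally have "s = q @ q" .
  moreover have "odd (o_sigma \<sigma> q)"
    using assms(2) d by (simp add: admissible_def q_def)
  moreover have "\<not> periodic c q\<^sup>\<omega>" if "0 < c" "c < length q" for c
    using half[of c] half[OF d] that d(2) q by auto
  then have "primitive q" using primitive_iff_not_periodic[OF q(2)] by blast
  ultimately show ?thesis using that by blast
qed

lemma admissible_iter_iff:
  assumes "s \<in> words (length \<sigma>) n" "n > 0"
  shows "admissible \<sigma> n s\<^sup>\<omega> \<longleftrightarrow>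
    primitive s \<or> (\<exists>q. s = q @ q \<and> primitive q \<and> odd (o_sigma \<sigma> q))"
proof
  have len: "length s = n" "s \<noteq> []" using assms by (auto simp: words_def)
  show "primitive s \<or> (\<exists>q. s = q @ q \<and> primitive q \<and> odd (o_sigma \<sigma> q))" if "admissible \<sigma> n s\<^sup>\<omega>"
    using that admissible_iter_not_primitive[of s \<sigma>] len by metis
  have "admissible \<sigma> n s\<^sup>\<omega>" if "primitive s"
    unfolding admissible_iter_iff_periods[OF assms]
    using that primitive_iff_not_periodic len by blast
  then show "admissible \<sigma> n s\<^sup>\<omega>"
    if "primitive s \<or> (\<exists>q. s = q @ q \<and> primitive q \<and> odd (o_sigma \<sigma> q))"
    using that admissible_iter_append_self assms by blast
qed

lemma ex_rotate_inverse: "\<exists>j'. rotate j' (rotate j s) = s"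
proof (cases "s = []")
  case False
  then have "j \<le> j * length s" by (cases s) auto
  then have "rotate (j * length s - j) (rotate j s) = s" by (simp add: rotate_rotate rotate_id)
  then show ?thesis ..
qed simp

lemma necklace_eq_iff: "necklace s = necklace s' \<longleftrightarrow> (\<exists>j. s' = rotate j s)"
proof
  have "s' = rotate 0 s'" by simp
  then have "s' \<in> necklace s'" unfolding necklace_def by blast
  then show "\<exists>j. s' = rotate j s" if "necklace s = necklace s'"
    using that unfolding necklace_def by auto
next
  have subset: "necklace (rotate j s) \<subseteq> necklace s" for j s
    unfolding necklace_def by (auto simp: rotate_rotate)
  assume "\<exists>j. s' = rotate j s"
  then obtain j j' where "s' = rotate j s" "s = rotate j' s'" using ex_rotate_inverse by metis
  then show "necklace s = necklace s'" using subset by (metis subset_antisym)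
qed

lemma necklace_prefix_eq_iff:
  assumes "periodic n w" "periodic n w'" "n > 0"
  shows "necklace (prefix n w) = necklace (prefix n w') \<longleftrightarrow> (\<exists>c. w' = suffix c w)"
proof -
  have "prefix n w' = rotate c (prefix n w) \<longleftrightarrow> w' = suffix c w" for c
    using iter_inject[of "prefix n w'" "rotate c (prefix n w)"] suffix_iter[of "prefix n w" c]
      iter_prefix[OF assms(1,3)] iter_prefix[OF assms(2,3)] assms(3)
    by (auto dest: arg_cong[of _ _ iter])
  then show ?thesis by (simp add: necklace_eq_iff)
qed

lemma rotate_append_self: "rotate j (q @ q) = rotate j q @ rotate j q"
proof (induction j)
  case (Suc j)
  have "rotate1 (q @ q) = rotate1 q @ rotate1 q" for q :: "'a list" by (cases q) auto
  then show ?case using Suc by simp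
qed simp

lemma necklace_append_self: "necklace (q @ q) = (\<lambda>s. s @ s) ` necklace q"
  unfolding necklace_def by (auto simp: rotate_append_self)

lemma not_primitive_append_self: "\<not> primitive (q @ q)"
proof -
  have "q @ q = concat (replicate 2 q)" by (simp add: numeral_2_eq_2)
  moreover have "(2 :: nat) > 1" by simp
  ultimately show ?thesis unfolding primitive_def by blast
qed

lemma finite_words: "finite (words k n)"
  using finite_lists_length_eq[of "{0..<k}" n] by (simp add: words_def conj_commute)

lemma card_necklaces_append_self:
  "card (necklace ` (\<lambda>q. q @ q) ` Q) = card (necklace ` Q)"
proof -
  have "inj (\<lambda>s :: nat list. s @ s)"
  proof (rule injI)
    fix s s' :: "nat list" assume eq: "s @ s = s' @ s'"
    have "length (s @ s) = length (s' @ s')" by (simp only: eq)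
    then have "length s = length s'" by simp
    then show "s = s'" using eq by simp
  qed
  then have "inj_on (image (\<lambda>s. s @ s)) (necklace ` Q)"
    by (meson inj_image_eq_iff inj_onI)
  moreover have "necklace ` (\<lambda>q. q @ q) ` Q = image (\<lambda>s. s @ s) ` necklace ` Q"
    by (simp add: image_image necklace_append_self)
  ultimately show ?thesis by (simp add: card_image)
qed

lemma card_admissible_necklaces:
  assumes "n > 0"
  shows "card (necklace ` {s \<in> words (length \<sigma>) n. admissible \<sigma> n s\<^sup>\<omega>}) =
    L_star (length \<sigma>) n \<sigma>"
proof -
  define P where "P = {s \<in> words (length \<sigma>) n. primitive s}"
  define Q where "Q = {q. q @ q \<in> words (length \<sigma>) n \<and> primitive q \<and> odd (o_sigma \<sigma> q)}"
  have Q: "Q = (if even n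
      then {q \<in> words (length \<sigma>) (n div 2). primitive q \<and> odd (o_sigma \<sigma> q)} else {})"
    unfolding Q_def words_def by auto
  have finite: "finite P" "finite Q" unfolding P_def Q by (simp_all add: finite_words)
  have "necklace (q @ q) \<noteq> necklace s" if "primitive s" for q s
    using that not_primitive_append_self by (auto simp: necklace_eq_iff rotate_append_self)
  then have "necklace ` P \<inter> necklace ` (\<lambda>q. q @ q) ` Q = {}"
    unfolding P_def by fastforce
  moreover have "{s \<in> words (length \<sigma>) n. admissible \<sigma> n s\<^sup>\<omega>} = P \<union> (\<lambda>q. q @ q) ` Q"
    using admissible_iter_iff[OF _ assms] by (auto simp: P_def Q_def)
  ultimately have "card (necklace ` {s \<in> words (length \<sigma>) n. admissible \<sigma> n s\<^sup>\<omega>}) =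
      card (necklace ` P) + card (necklace ` Q)"
    using finite by (simp add: image_Un card_Un_disjoint card_necklaces_append_self)
  also have "\<dots> = L_star (length \<sigma>) n \<sigma>"
    by (simp add: L_star_def L_def L_sigma_def prim_necklaces_def P_def Q)
  finally show ?thesis .
qed

section \<open>Segmentations\<close>

definition cuts :: "nat \<Rightarrow> nat \<Rightarrow> nat list set" where
  "cuts k n = {e. length e = Suc k \<and> e ! 0 = 0 \<and> e ! k = n \<and> sorted e}"

definition segmentations :: "bool list \<Rightarrow> nat \<Rightarrow> (nat \<Rightarrow> 'a::ord) \<Rightarrow> nat list set" where
  "segmentations \<sigma> n f = {e \<in> cuts (length \<sigma>) n.
     \<forall>i<length \<sigma>. monotone_on {e ! i<..e ! Suc i} (<) (signed_less (\<sigma> ! i)) f}"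

lemma cuts_nth_mono: "e \<in> cuts k n \<Longrightarrow> i \<le> j \<Longrightarrow> j \<le> k \<Longrightarrow> e ! i \<le> e ! j"
  by (simp add: cuts_def sorted_nth_mono)

lemma cuts_nth_le: "e \<in> cuts k n \<Longrightarrow> i \<le> k \<Longrightarrow> e ! i \<le> n"
  using cuts_nth_mono[of e k n i k] by (simp add: cuts_def)

lemma finite_cuts: "finite (cuts k n)"
proof (rule finite_subset)
  show "cuts k n \<subseteq> {e. set e \<subseteq> {..n} \<and> length e = Suc k}"
    using cuts_nth_le[of _ k n] by (force simp: cuts_def in_set_conv_nth)
qed (simp add: finite_lists_length_eq)

lemma finite_segmentations: "finite (segmentations \<sigma> n f)"
  by (rule finite_subset[OF _ finite_cuts]) (auto simp: segmentations_def)

lemma sorted_wrt_segment_iff: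
  assumes "b \<le> length xs"
  shows "sorted_wrt R (segment xs a b) \<longleftrightarrow> monotone_on {a<..b} (<) R (perm_fun xs)"
proof
  assume sorted: "sorted_wrt R (segment xs a b)"
  show "monotone_on {a<..b} (<) R (perm_fun xs)"
  proof (rule monotone_onI)
    fix x y assume "x \<in> {a<..b}" "y \<in> {a<..b}" "x < y"
    then show "R (perm_fun xs x) (perm_fun xs y)"
      using sorted_wrt_nth_less[OF sorted, of "x - 1 - a" "y - 1 - a"] assms
      by (auto simp: segment_def perm_fun_def)
  qed
next
  assume mono: "monotone_on {a<..b} (<) R (perm_fun xs)"
  show "sorted_wrt R (segment xs a b)"
    unfolding sorted_wrt_iff_nth_less
  proof (intro allI impI)
    fix i j assume "i < j" "j < length (segment xs a b)"
    then show "R (segment xs a b ! i) (segment xs a b ! j)"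
      using monotone_onD[OF mono, of "Suc (a + i)" "Suc (a + j)"]
      by (auto simp: segment_def perm_fun_def)
  qed
qed

lemma segmentations_neq_empty_iff:
  assumes "length xs = n"
  shows "segmentations \<sigma> n (perm_fun xs) \<noteq> {} \<longleftrightarrow>
    (\<exists>e. e 0 = 0 \<and> e (length \<sigma>) = n \<and> (\<forall>i<length \<sigma>. e i \<le> e (Suc i)) \<and>
      (\<forall>i<length \<sigma>. sorted_wrt (signed_less (\<sigma> ! i)) (segment xs (e i) (e (Suc i)))))"
    (is "_ \<longleftrightarrow> (\<exists>e. ?segmented e)")
proof
  assume "segmentations \<sigma> n (perm_fun xs) \<noteq> {}"
  then obtain es where es: "es \<in> cuts (length \<sigma>) n"
    "\<forall>i<length \<sigma>. monotone_on {es ! i<..es ! Suc i} (<) (signed_less (\<sigma> ! i)) (perm_fun xs)"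
    unfolding segmentations_def by blast
  have "?segmented ((!) es)"
    using cuts_nth_mono[OF es(1)] cuts_nth_le[OF es(1)] es assms
    by (auto simp: cuts_def sorted_wrt_segment_iff)
  then show "\<exists>e. ?segmented e" by (rule exI[of ?segmented])
next
  assume "\<exists>e. ?segmented e"
  then obtain e where e: "?segmented e" ..
  define es where "es = map e [0..<Suc (length \<sigma>)]"
  have nth: "es ! i = e i" if "i \<le> length \<sigma>" for i
    using that by (simp add: es_def del: upt_Suc)
  have "length es = Suc (length \<sigma>)" by (simp add: es_def)
  then have es: "es \<in> cuts (length \<sigma>) n"
    using e nth by (simp add: cuts_def sorted_iff_nth_Suc)
  have "monotone_on {es ! i<..es ! Suc i} (<) (signed_less (\<sigma> ! i)) (perm_fun xs)"
    if "i < length \<sigma>" for i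
    using e that cuts_nth_le[OF es, of "Suc i"] assms
    by (simp add: nth flip: sorted_wrt_segment_iff)
  then show "segmentations \<sigma> n (perm_fun xs) \<noteq> {}"
    using es unfolding segmentations_def by blast
qed

lemma shape_perms_eq:
  "shape_perms \<sigma> n = {xs \<in> perms n. segmentations \<sigma> n (perm_fun xs) \<noteq> {}}"
proof -
  have sorted_iff:
    "(if s then sorted_wrt (<) ys else sorted_wrt (>) ys) = sorted_wrt (signed_less s) ys"
    for s and ys :: "nat list" by simp
  show ?thesis
    unfolding shape_perms_def sorted_iff
    by (intro Collect_cong conj_cong refl) (simp add: perms_def segmentations_neq_empty_iff)
qed

lemma cyclic_shape_perms_eq:
  "cyclic_shape_perms \<sigma> n = {xs \<in> cyclic_perms n. segmentations \<sigma> n (perm_fun xs) \<noteq> {}}"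
  by (auto simp: cyclic_shape_perms_def shape_perms_eq cyclic_perms_def)

definition segment_index :: "nat list \<Rightarrow> nat \<Rightarrow> nat" where
  "segment_index e x = (LEAST i. x \<le> e ! Suc i)"

lemma segment_index_less_iff:
  assumes "e \<in> cuts k n" "x \<in> {1..n}" "i \<le> k"
  shows "segment_index e x < i \<longleftrightarrow> x \<le> e ! i"
proof
  have ends: "e ! 0 = 0" "e ! k = n" using assms(1) by (simp_all add: cuts_def)
  then obtain k' where k: "k = Suc k'" using assms(2) by (cases k) auto
  have "x \<le> e ! Suc k'" using ends k assms(2) by simp
  then have "x \<le> e ! Suc (segment_index e x)"
    unfolding segment_index_def by (rule LeastI)
  also assume "segment_index e x < i"
  then have "e ! Suc (segment_index e x) \<le> e ! i"
    using assms(3) by (intro cuts_nth_mono[OF assms(1)]) auto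
  finally show "x \<le> e ! i" .
next
  assume le: "x \<le> e ! i"
  then obtain i' where "i = Suc i'" using assms(1,2) by (cases i) (auto simp: cuts_def)
  then show "segment_index e x < i"
    using le unfolding segment_index_def by (simp add: Least_le less_Suc_eq_le)
qed

lemma segment_index_less: "e \<in> cuts k n \<Longrightarrow> x \<in> {1..n} \<Longrightarrow> segment_index e x < k"
  using segment_index_less_iff[of e k n x k] by (simp add: cuts_def)

lemma segment_index_eq_iff:
  assumes "e \<in> cuts k n" "x \<in> {1..n}" "i < k"
  shows "segment_index e x = i \<longleftrightarrow> x \<in> {e ! i<..e ! Suc i}"
  using segment_index_less_iff[OF assms(1,2), of i] assms(3)
    segment_index_less_iff[OF assms(1,2), of "Suc i"]
  by auto

lemma segment_index_mono:
  assumes "e \<in> cuts k n" "x \<in> {1..n}" "y \<in> {1..n}" "x \<le> y"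
  shows "segment_index e x \<le> segment_index e y"
proof -
  have "y \<le> e ! Suc (segment_index e y)"
    using segment_index_less_iff[OF assms(1,3), of "Suc (segment_index e y)"]
      segment_index_less[OF assms(1,3)] by simp
  then show ?thesis
    using assms(4) unfolding segment_index_def by (intro Least_le) simp
qed

lemma segmentations_iff_segment_index:
  assumes e: "e \<in> cuts (length \<sigma>) n"
  shows "e \<in> segmentations \<sigma> n f \<longleftrightarrow> (\<forall>x\<in>{1..n}. \<forall>y\<in>{1..n}.
      segment_index e x = segment_index e y \<longrightarrow> x < y \<longrightarrow>
      signed_less (\<sigma> ! segment_index e x) (f x) (f y))" (is "_ \<longleftrightarrow> ?monotone")
proof
  assume seg: "e \<in> segmentations \<sigma> n f"
  show ?monotone
  proof (intro ballI impI)
    fix x y assume xy: "x \<in> {1..n}" "y \<in> {1..n}" "segment_index e x = segment_index e y" "x < y"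
    define i where "i = segment_index e x"
    have i: "i < length \<sigma>" unfolding i_def by (rule segment_index_less[OF e xy(1)])
    then have "x \<in> {e ! i<..e ! Suc i}" "y \<in> {e ! i<..e ! Suc i}"
      using segment_index_eq_iff[OF e] xy by (metis i_def)+
    then show "signed_less (\<sigma> ! segment_index e x) (f x) (f y)"
      using seg i xy(4) unfolding i_def[symmetric] segmentations_def by (auto intro: monotone_onD)
  qed
next
  assume less: ?monotone
  have "monotone_on {e ! i<..e ! Suc i} (<) (signed_less (\<sigma> ! i)) f" if i: "i < length \<sigma>" for i
  proof (rule monotone_onI)
    fix x y assume xy: "x \<in> {e ! i<..e ! Suc i}" "y \<in> {e ! i<..e ! Suc i}" "x < y"
    then have "x \<in> {1..n}" "y \<in> {1..n}" using cuts_nth_le[OF e, of "Suc i"] i by auto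
    moreover from this have "segment_index e x = i" "segment_index e y = i"
      using segment_index_eq_iff[OF e _ i] xy(1,2) by blast+
    ultimately show "signed_less (\<sigma> ! i) (f x) (f y)" using less xy(3) by metis
  qed
  then show "e \<in> segmentations \<sigma> n f" using e by (simp add: segmentations_def)
qed

lemma segment_index_inject:
  assumes "e \<in> cuts k n" "e' \<in> cuts k n" "\<And>x. x \<in> {1..n} \<Longrightarrow> segment_index e x = segment_index e' x"
  shows "e = e'"
proof (rule nth_equalityI)
  show "length e = length e'" using assms(1,2) by (simp add: cuts_def)
  fix i assume "i < length e"
  then have i: "i \<le> k" using assms(1) by (simp add: cuts_def)
  have le_iff: "x \<le> e ! i \<longleftrightarrow> x \<le> e' ! i" if "x \<in> {1..n}" for x
    using segment_index_less_iff[OF _ that i] assms that by metis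
  show "e ! i = e' ! i"
    using le_iff[of "e ! i"] le_iff[of "e' ! i"]
      cuts_nth_le[OF assms(1) i] cuts_nth_le[OF assms(2) i]
    by (cases "e ! i = 0"; cases "e' ! i = 0") auto
qed

lemma le_card_level_set_iff:
  fixes g :: "nat \<Rightarrow> 'a::linorder"
  assumes "mono_on {1..n} g" "x \<in> {1..n}"
  shows "x \<le> card {y \<in> {1..n}. g y < c} \<longleftrightarrow> g x < c"
proof
  assume "g x < c"
  then have "{1..x} \<subseteq> {y \<in> {1..n}. g y < c}"
    using assms(2) mono_onD[OF assms(1), of _ x] by (fastforce intro: le_less_trans)
  then have "card {1..x} \<le> card {y \<in> {1..n}. g y < c}" by (intro card_mono) auto
  then show "x \<le> card {y \<in> {1..n}. g y < c}" by simp
next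
  assume le: "x \<le> card {y \<in> {1..n}. g y < c}"
  show "g x < c"
  proof (rule ccontr)
    assume "\<not> g x < c"
    then have "{y \<in> {1..n}. g y < c} \<subseteq> {1..<x}"
      using assms(2) mono_onD[OF assms(1), of x] by (fastforce simp: not_less[symmetric])
    then have "card {y \<in> {1..n}. g y < c} \<le> card {1..<x}" by (intro card_mono) auto
    then show False using le assms(2) by auto
  qed
qed

lemma ex_cuts_segment_index:
  assumes "mono_on {1..n} g" "g ` {1..n} \<subseteq> {..<k}"
  obtains e where "e \<in> cuts k n" "\<And>x. x \<in> {1..n} \<Longrightarrow> segment_index e x = g x"
proof
  define e where "e = map (\<lambda>i. card {x \<in> {1..n}. g x < i}) [0..<Suc k]"
  have length: "length e = Suc k" by (simp add: e_def)
  have nth: "e ! i = card {x \<in> {1..n}. g x < i}" if "i \<le> k" for i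
    using that by (simp add: e_def del: upt_Suc)
  have "{x \<in> {1..n}. g x < k} = {1..n}" using assms(2) by auto
  then have "e ! k = n" by (simp add: nth)
  moreover have "sorted e"
    unfolding e_def by (auto simp: sorted_iff_nth_Suc simp del: upt_Suc intro!: card_mono)
  ultimately show e: "e \<in> cuts k n" using nth[of 0] length by (simp add: cuts_def)
  fix x assume x: "x \<in> {1..n}"
  have less_iff: "segment_index e x < i \<longleftrightarrow> g x < i" if "i \<le> k" for i
    using segment_index_less_iff[OF e x that] le_card_level_set_iff[OF assms(1) x] nth[OF that]
    by simp
  have "g x \<in> {..<k}" using assms(2) x by blast
  then show "segment_index e x = g x"
    using less_iff[of "g x"] less_iff[of "segment_index e x"] segment_index_less[OF e x] by simp
qed

section \<open>Segmented cyclic permutations\<close>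

lemma bij_betw_perm_fun:
  assumes "xs \<in> perms n"
  shows "bij_betw (perm_fun xs) {1..n} {1..n}"
proof -
  have "bij_betw ((!) xs) {..<n} {1..n}"
    using assms bij_betw_nth[of xs] by (auto simp: perms_def)
  moreover have "bij_betw (\<lambda>i. i - 1) {1..n} {..<n}"
    by (rule bij_betw_byWitness[of _ Suc]) auto
  ultimately show ?thesis
    using bij_betw_trans[of "\<lambda>i. i - 1" "{1..n}" "{..<n}" "(!) xs"]
    by (simp add: perm_fun_def[abs_def] comp_def)
qed

lemma perm_fun_inject:
  assumes "xs \<in> perms n" "xs' \<in> perms n" "\<And>x. x \<in> {1..n} \<Longrightarrow> perm_fun xs x = perm_fun xs' x"
  shows "xs = xs'"
proof (rule nth_equalityI)
  show "length xs = length xs'" using assms(1,2) by (simp add: perms_def)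
  show "xs ! i = xs' ! i" if "i < length xs" for i
    using assms(3)[of "Suc i"] assms(1) that by (simp add: perm_fun_def perms_def)
qed

definition iterates :: "nat list \<Rightarrow> nat \<Rightarrow> nat" where
  "iterates xs t = (perm_fun xs ^^ t) 1"

lemma iterates_Suc: "iterates xs (Suc t) = perm_fun xs (iterates xs t)"
  by (simp add: iterates_def)

lemma cyclic_perms_iff: "xs \<in> cyclic_perms n \<longleftrightarrow> xs \<in> perms n \<and> range (iterates xs) = {1..n}"
  by (auto simp: cyclic_perms_def iterates_def full_SetCompr_eq)

lemma cyclic_sequence_iterates:
  assumes "xs \<in> cyclic_perms n" "n > 0"
  shows "cyclic_sequence n (iterates xs)"
proof -
  let ?d = "funpow_dist1 (perm_fun xs) 1 1"
  have bij: "bij_betw (perm_fun xs) {1..n} {1..n}" and range: "range (iterates xs) = {1..n}"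
    using assms(1) bij_betw_perm_fun by (auto simp: cyclic_perms_iff)
  have "1 \<in> {1..n}" using assms(2) by simp
  then obtain x where "x \<in> {1..n}" "perm_fun xs x = 1"
    using bij unfolding bij_betw_def by (metis imageE)
  then obtain t where "iterates xs (Suc t) = 1" using range by (metis imageE iterates_Suc)
  then have self: "1 \<in> orbit (perm_fun xs) 1"
    unfolding orbit_altdef iterates_def by (intro CollectI exI[of _ "Suc t"]) simp
  have image: "iterates xs ` {..<?d} = {1..n}"
    using orbit_conv_funpow_dist1[OF self] orbit_altdef_self_in[OF self] range
    by (simp add: iterates_def[abs_def] lessThan_atLeast0 full_SetCompr_eq)
  have inj: "inj_on (iterates xs) {..<?d}"
    using inj_on_funpow_dist1[OF self] by (simp add: iterates_def[abs_def] lessThan_atLeast0)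
  have d: "?d = n" using card_image[OF inj] image by simp
  show ?thesis
  proof
    show "bij_betw (iterates xs) {..<n} {1..n}"
      using inj image unfolding d by (rule bij_betw_imageI)
    have "(perm_fun xs ^^ n) 1 = 1" using funpow_dist1_prop[OF self] unfolding d .
    then show "periodic n (iterates xs)" by (simp add: periodic_iff iterates_def funpow_add)
  qed (rule assms(2))
qed

lemma (in cyclic_sequence) ex_cyclic_perm:
  assumes "p 0 = 1"
  obtains xs where "xs \<in> cyclic_perms n" "iterates xs = p"
proof
  define xs where "xs = map (\<lambda>x. p (Suc (inv p x))) [1..<Suc n]"
  have "p (inv p (p t)) = p t" for t by (simp add: f_inv_into_f)
  then have step: "perm_fun xs (p t) = p (Suc t)" for t
    using point_range[of t] point_Suc_eq[of "inv p (p t)" t]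
    by (auto simp: perm_fun_def xs_def simp del: upt_Suc)
  have "iterates xs t = p t" for t
    by (induction t) (simp_all add: iterates_Suc step, simp add: iterates_def assms)
  then show iterates: "iterates xs = p" ..
  have "{1..n} \<subseteq> range p" using ex_point by (metis rangeI subsetI)
  then have range: "range p = {1..n}" using point_range by blast
  have "{1..n} \<subseteq> set xs"
  proof
    fix y assume "y \<in> {1..n}"
    then obtain t where "p t = y" using ex_point by blast
    moreover define u where "u = t + (n - 1)"
    ultimately have "y = perm_fun xs (p u)"
      using pos periodic_point by (simp add: step periodic_iff)
    moreover have "p u - 1 < length xs" using point_range[of u] by (auto simp: xs_def)
    ultimately show "y \<in> set xs" by (simp add: perm_fun_def)
  qed
  then have "set xs = {1..n}" using point_range by (auto simp: xs_def)
  moreover have "length xs = n" by (simp add: xs_def)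
  ultimately have "xs \<in> perms n" by (simp add: perms_def card_distinct)
  then show "xs \<in> cyclic_perms n" by (simp add: cyclic_perms_iff iterates range)
qed

lemma iterates_inject:
  assumes "xs \<in> cyclic_perms n" "xs' \<in> cyclic_perms n" "iterates xs = iterates xs'"
  shows "xs = xs'"
proof (rule perm_fun_inject)
  fix x assume "x \<in> {1..n}"
  then have "x \<in> range (iterates xs)" using assms(1) by (simp only: cyclic_perms_iff)
  then obtain t where "x = iterates xs t" by blast
  then show "perm_fun xs x = perm_fun xs' x"
    using assms(3) iterates_Suc[of xs t] iterates_Suc[of xs' t] by simp
qed (use assms(1,2) in \<open>auto simp: cyclic_perms_iff\<close>)

definition orbit_word :: "nat list \<Rightarrow> nat list \<Rightarrow> nat \<Rightarrow> nat" where
  "orbit_word xs e t = segment_index e (iterates xs t)"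

lemma signed_orbit_segmentation:
  assumes "xs \<in> cyclic_perms n" "n > 0" "e \<in> segmentations \<sigma> n (perm_fun xs)"
  shows "signed_orbit n (iterates xs) \<sigma> (orbit_word xs e)"
proof -
  interpret cyclic_sequence n "iterates xs" by (rule cyclic_sequence_iterates[OF assms(1,2)])
  have e: "e \<in> cuts (length \<sigma>) n" using assms(3) by (simp add: segmentations_def)
  show ?thesis
  proof
    show "orbit_word xs e t < length \<sigma>" for t
      unfolding orbit_word_def by (rule segment_index_less[OF e point_range])
    show "orbit_word xs e t \<le> orbit_word xs e u" if "iterates xs t \<le> iterates xs u" for t u
      unfolding orbit_word_def by (rule segment_index_mono[OF e point_range point_range that])
    show "signed_less (\<sigma> ! orbit_word xs e t) (iterates xs (Suc t)) (iterates xs (Suc u))"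
      if "orbit_word xs e t = orbit_word xs e u" "iterates xs t < iterates xs u" for t u
      using assms(3) that point_range
      unfolding segmentations_iff_segment_index[OF e] orbit_word_def iterates_Suc by blast
  qed
qed

lemma (in signed_orbit) ex_segmentation:
  assumes "p 0 = 1"
  obtains xs e where "xs \<in> cyclic_perms n" "e \<in> segmentations \<sigma> n (perm_fun xs)"
    "orbit_word xs e = w"
proof -
  obtain xs where xs: "xs \<in> cyclic_perms n" "iterates xs = p" using ex_cyclic_perm[OF assms] .
  have perm_fun: "perm_fun xs (p t) = p (Suc t)" for t using iterates_Suc[of xs t] by (simp add: xs)
  define g where "g x = w (inv p x)" for x
  have g: "g (p t) = w t" for t unfolding g_def by (rule letter_eq) (simp add: f_inv_into_f)
  have "mono_on {1..n} g"
    using ex_point letter_mono by (intro mono_onI) (metis g)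
  moreover have "g ` {1..n} \<subseteq> {..<length \<sigma>}" using letter_less by (auto simp: g_def)
  ultimately obtain e where e: "e \<in> cuts (length \<sigma>) n"
    and index: "\<And>x. x \<in> {1..n} \<Longrightarrow> segment_index e x = g x"
    by (rule ex_cuts_segment_index) blast
  have "signed_less (\<sigma> ! segment_index e x) (perm_fun xs x) (perm_fun xs y)"
    if xy: "x \<in> {1..n}" "y \<in> {1..n}" "segment_index e x = segment_index e y" "x < y" for x y
  proof -
    obtain t u where "x = p t" "y = p u" using xy(1,2) ex_point by metis
    then show ?thesis using step[of t u] xy by (simp add: index g perm_fun)
  qed
  then have "e \<in> segmentations \<sigma> n (perm_fun xs)"
    by (simp add: segmentations_iff_segment_index[OF e])
  moreover have "orbit_word xs e = w"
    using index[OF point_range] by (simp add: fun_eq_iff orbit_word_def xs(2) g)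
  ultimately show ?thesis using that xs(1) by blast
qed

definition segmented_cyclic_perms :: "bool list \<Rightarrow> nat \<Rightarrow> (nat list \<times> nat list) set" where
  "segmented_cyclic_perms \<sigma> n = (SIGMA xs:cyclic_perms n. segmentations \<sigma> n (perm_fun xs))"

definition orbit_necklace :: "nat \<Rightarrow> nat list \<times> nat list \<Rightarrow> nat list set" where
  "orbit_necklace n = (\<lambda>(xs, e). necklace (prefix n (orbit_word xs e)))"

lemma inj_on_orbit_necklace:
  assumes "n > 0"
  shows "inj_on (orbit_necklace n) (segmented_cyclic_perms \<sigma> n)"
proof (rule inj_onI, safe)
  fix xs e xs' e'
  assume "(xs, e) \<in> segmented_cyclic_perms \<sigma> n" "(xs', e') \<in> segmented_cyclic_perms \<sigma> n"
    and eq: "orbit_necklace n (xs, e) = orbit_necklace n (xs', e')"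
  then have xs: "xs \<in> cyclic_perms n" "e \<in> segmentations \<sigma> n (perm_fun xs)"
    and xs': "xs' \<in> cyclic_perms n" "e' \<in> segmentations \<sigma> n (perm_fun xs')"
    by (auto simp: segmented_cyclic_perms_def)
  interpret orbit: signed_orbit n "iterates xs" \<sigma> "orbit_word xs e"
    by (rule signed_orbit_segmentation[OF xs(1) assms xs(2)])
  interpret orbit': signed_orbit n "iterates xs'" \<sigma> "orbit_word xs' e'"
    by (rule signed_orbit_segmentation[OF xs'(1) assms xs'(2)])
  have start: "iterates xs 0 = 1" "iterates xs' 0 = 1" by (simp_all add: iterates_def)
  obtain c where c: "orbit_word xs' e' = suffix c (orbit_word xs e)"
    using eq necklace_prefix_eq_iff[OF orbit.periodic_letter orbit'.periodic_letter assms]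
    by (auto simp: orbit_necklace_def)
  have word: "orbit_word xs' e' = orbit_word xs e"
    using suffix_eq_of_signed_orbits_from_1 orbit.signed_orbit_axioms start(1)
      orbit'.signed_orbit_axioms[unfolded c] start(2) unfolding c by blast
  have iterates: "iterates xs = iterates xs'"
    using orbit.point_eq_orbit_of_word[OF start(1)] orbit'.point_eq_orbit_of_word[OF start(2)] word
    by simp
  show "xs = xs'" using iterates_inject[OF xs(1) xs'(1) iterates] .
  show "e = e'"
  proof (rule segment_index_inject)
    show "e \<in> cuts (length \<sigma>) n" "e' \<in> cuts (length \<sigma>) n"
      using xs xs' by (auto simp: segmentations_def)
    fix x assume "x \<in> {1..n}"
    then obtain t where "iterates xs t = x" using orbit.ex_point by blast
    then show "segment_index e x = segment_index e' x"
      using fun_cong[OF word, of t] iterates by (simp add: orbit_word_def)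
  qed
qed

lemma orbit_necklace_image:
  assumes "n > 0"
  shows "orbit_necklace n ` segmented_cyclic_perms \<sigma> n =
    necklace ` {s \<in> words (length \<sigma>) n. admissible \<sigma> n s\<^sup>\<omega>}"
proof safe
  fix xs e assume "(xs, e) \<in> segmented_cyclic_perms \<sigma> n"
  then interpret signed_orbit n "iterates xs" \<sigma> "orbit_word xs e"
    using signed_orbit_segmentation assms by (auto simp: segmented_cyclic_perms_def)
  have "prefix n (orbit_word xs e) \<in> words (length \<sigma>) n"
    using letter_less by (auto simp: words_def)
  moreover have "admissible \<sigma> n (prefix n (orbit_word xs e))\<^sup>\<omega>"
    using admissible by (simp add: iter_prefix[OF periodic_letter assms])
  ultimately show "orbit_necklace n (xs, e) \<in>
      necklace ` {s \<in> words (length \<sigma>) n. admissible \<sigma> n s\<^sup>\<omega>}"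
    by (auto simp: orbit_necklace_def)
next
  fix s assume s: "s \<in> words (length \<sigma>) n" "admissible \<sigma> n s\<^sup>\<omega>"
  have len: "length s = n" "s \<noteq> []" using s(1) assms by (auto simp: words_def)
  obtain p c where "signed_orbit n p \<sigma> (suffix c s\<^sup>\<omega>)" and p: "p 0 = 1"
    using ex_signed_orbit_from_1[OF s(2) assms] .
  then interpret signed_orbit n p \<sigma> "suffix c s\<^sup>\<omega>" by blast
  obtain xs e where xs: "xs \<in> cyclic_perms n" "e \<in> segmentations \<sigma> n (perm_fun xs)"
    and word: "orbit_word xs e = suffix c s\<^sup>\<omega>" using ex_segmentation[OF p] .
  have "necklace (prefix n s\<^sup>\<omega>) = necklace (prefix n (orbit_word xs e))"
    using necklace_prefix_eq_iff[of n "s\<^sup>\<omega>" "orbit_word xs e"] periodic_iter[OF len(2)]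
      periodic_letter len(1) assms unfolding word by blast
  then have "orbit_necklace n (xs, e) = necklace s"
    using prefix_iter[OF len(2)] len(1) by (simp add: orbit_necklace_def)
  moreover have "(xs, e) \<in> segmented_cyclic_perms \<sigma> n"
    using xs by (simp add: segmented_cyclic_perms_def)
  ultimately show "necklace s \<in> orbit_necklace n ` segmented_cyclic_perms \<sigma> n" by (metis imageI)
qed

theorem card_segmented_cyclic_perms:
  assumes "n > 0"
  shows "card (segmented_cyclic_perms \<sigma> n) = L_star (length \<sigma>) n \<sigma>"
  using card_image[OF inj_on_orbit_necklace[OF assms]]
    orbit_necklace_image[OF assms] card_admissible_necklaces[OF assms] by simp

section \<open>Counting segmentations\<close>

definition peak_cuts :: "nat \<Rightarrow> nat \<Rightarrow> (nat \<Rightarrow> 'a::ord) \<Rightarrow> nat set" where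
  "peak_cuts a n f = {b \<in> {a..n}. strict_mono_on {a<..b} f \<and> strict_antimono_on {b<..n} f}"

lemma segmentations_plus_minus:
  "segmentations [True, False] n f = (\<lambda>b. [0, b, n]) ` peak_cuts 0 n f"
proof -
  have "e \<in> segmentations [True, False] n f \<longleftrightarrow> (\<exists>b\<in>peak_cuts 0 n f. e = [0, b, n])" for e
    by (auto simp: segmentations_def cuts_def peak_cuts_def All_less_Suc length_Suc_conv
        numeral_2_eq_2)
  then show ?thesis by blast
qed

lemma segmentations_plus_plus_minus:
  "segmentations [True, True, False] n f =
    (\<lambda>(a, b). [0, a, b, n]) ` (SIGMA a:{a \<in> {..n}. strict_mono_on {0<..a} f}. peak_cuts a n f)"
proof -
  have "e \<in> segmentations [True, True, False] n f \<longleftrightarrow>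
      (\<exists>a\<in>{a \<in> {..n}. strict_mono_on {0<..a} f}. \<exists>b\<in>peak_cuts a n f. e = [0, a, b, n])" for e
    by (auto simp: segmentations_def cuts_def peak_cuts_def All_less_Suc length_Suc_conv
        numeral_2_eq_2 numeral_3_eq_3)
  then show ?thesis by (auto simp: image_iff)
qed

lemma peak_cuts_eq:
  fixes f :: "nat \<Rightarrow> 'a::linorder"
  assumes p: "a < p" "p \<le> n" and max: "\<And>x. a < x \<Longrightarrow> x \<le> n \<Longrightarrow> x \<noteq> p \<Longrightarrow> f x < f p"
    and "peak_cuts a n f \<noteq> {}"
  shows "peak_cuts a n f = {p - 1, p}"
proof -
  have peak: "b = p - 1 \<or> b = p" if "b \<in> peak_cuts a n f" for b
  proof -
    have b: "a \<le> b" "b \<le> n"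
      and inc: "strict_mono_on {a<..b} f" and dec: "strict_antimono_on {b<..n} f"
      using that by (auto simp: peak_cuts_def)
    have "\<not> p < b" using monotone_onD[OF inc, of p b] max[of b] b p by fastforce
    moreover have "\<not> Suc b < p"
      using monotone_onD[OF dec, of "Suc b" p] max[of "Suc b"] b p by fastforce
    ultimately show ?thesis by linarith
  qed
  obtain b where "b \<in> peak_cuts a n f" using assms(4) by blast
  then have b: "b = p - 1 \<or> b = p"
    and inc: "strict_mono_on {a<..b} f" and dec: "strict_antimono_on {b<..n} f"
    using peak by (auto simp: peak_cuts_def)
  have "strict_mono_on {a<..p} f"
  proof (rule monotone_onI)
    fix x y assume "x \<in> {a<..p}" "y \<in> {a<..p}" "x < y"
    then show "f x < f y" using b p max[of x] monotone_onD[OF inc, of x y] by (cases "y = p") auto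
  qed
  moreover have "strict_antimono_on {p - 1<..n} f"
  proof (rule monotone_onI)
    fix x y assume "x \<in> {p - 1<..n}" "y \<in> {p - 1<..n}" "x < y"
    then show "f x > f y" using b p max[of y] monotone_onD[OF dec, of x y] by (cases "x = p") auto
  qed
  ultimately have "{p - 1, p} \<subseteq> peak_cuts a n f"
    using p by (auto simp: peak_cuts_def monotone_on_def)
  then show ?thesis using peak by blast
qed

lemma card_peak_cuts:
  fixes f :: "nat \<Rightarrow> 'a::linorder"
  assumes "a < n" "inj_on f {a<..n}" "peak_cuts a n f \<noteq> {}"
  shows "card (peak_cuts a n f) = 2"
proof -
  have "Max (f ` {a<..n}) \<in> f ` {a<..n}" using assms(1) by (intro Max_in) auto
  then obtain p where p: "p \<in> {a<..n}" "f p = Max (f ` {a<..n})" by force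
  have "f x < f p" if "a < x" "x \<le> n" "x \<noteq> p" for x
  proof -
    have "f x \<le> f p" using that p(2) by simp
    moreover have "f x \<noteq> f p" using inj_onD[OF assms(2)] that p(1) by auto
    ultimately show ?thesis by simp
  qed
  then have "peak_cuts a n f = {p - 1, p}" using p(1) assms(3) by (intro peak_cuts_eq) auto
  moreover have "p - 1 \<noteq> p" using p(1) by auto
  ultimately show ?thesis by simp
qed

text \<open>A first cut at \<open>n\<close> is left out: it would require \<open>f\<close> to increase on all of \<open>[n]\<close>, which no cyclic
  permutation does when \<open>n \<ge> 2\<close>.\<close>

definition first_cuts :: "nat \<Rightarrow> (nat \<Rightarrow> 'a::ord) \<Rightarrow> nat set" where
  "first_cuts n f = {a \<in> {..<n}. strict_mono_on {0<..a} f \<and> peak_cuts a n f \<noteq> {}}"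

lemma card_segmentations_plus_plus_minus:
  fixes f :: "nat \<Rightarrow> 'a::linorder"
  assumes "inj_on f {1..n}" "\<not> strict_mono_on {0<..n} f"
  shows "card (segmentations [True, True, False] n f) = 2 * card (first_cuts n f)"
proof -
  let ?A = "{a \<in> {..n}. strict_mono_on {0<..a} f}"
  have finite: "finite (peak_cuts a n f)" for a by (simp add: peak_cuts_def)
  have "inj_on (\<lambda>(a, b). [0, a, b, n]) (Sigma ?A (\<lambda>a. peak_cuts a n f))" by (auto simp: inj_on_def)
  then have "card (segmentations [True, True, False] n f) = (\<Sum>a\<in>?A. card (peak_cuts a n f))"
    unfolding segmentations_plus_plus_minus by (simp add: card_image finite)
  also have "\<dots> = (\<Sum>a\<in>first_cuts n f. card (peak_cuts a n f))"
  proof (rule sum.mono_neutral_right)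
    show "first_cuts n f \<subseteq> ?A" by (auto simp: first_cuts_def)
    have "a < n" if "a \<in> ?A" for a using that assms(2) by (cases "a = n") auto
    then show "\<forall>a\<in>?A - first_cuts n f. card (peak_cuts a n f) = 0"
      by (auto simp: first_cuts_def)
  qed simp
  also have "\<dots> = (\<Sum>a\<in>first_cuts n f. 2)"
    by (intro sum.cong refl card_peak_cuts inj_on_subset[OF assms(1)]) (auto simp: first_cuts_def)
  finally show ?thesis by simp
qed

lemma strict_mono_on_glue:
  fixes f :: "nat \<Rightarrow> 'a::preorder"
  assumes inc: "strict_mono_on {c<..a'} f" and inc': "strict_mono_on {a<..b} f" and "c \<le> a" "a < a'"
  shows "strict_mono_on {c<..max a' b} f"
proof (rule monotone_onI)
  fix x y assume xy: "x \<in> {c<..max a' b}" "y \<in> {c<..max a' b}" "x < y"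
  consider "y \<le> a'" | "a < x" "a' < y" | "x \<le> a" "a' < y" by linarith
  then show "f x < f y"
  proof cases
    case 1
    then show ?thesis using xy by (intro monotone_onD[OF inc]) auto
  next
    case 2
    then show ?thesis using xy by (intro monotone_onD[OF inc']) auto
  next
    case 3
    then have "f x < f a'" using xy assms(3,4) by (intro monotone_onD[OF inc]) auto
    also have "f a' < f y" using 3 xy assms(3,4) by (intro monotone_onD[OF inc']) auto
    finally show ?thesis .
  qed
qed

lemma card_first_cuts_not_unimodal:
  fixes f :: "nat \<Rightarrow> 'a::linorder"
  assumes "first_cuts n f \<noteq> {}" "peak_cuts 0 n f = {}"
  shows "card (first_cuts n f) = 1"
proof -
  have "\<not> a < a'" if cuts: "a \<in> first_cuts n f" "a' \<in> first_cuts n f" for a a'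
  proof
    assume "a < a'"
    obtain b where "b \<in> peak_cuts a n f" using cuts(1) unfolding first_cuts_def by blast
    then have "max a' b \<in> peak_cuts 0 n f"
      using strict_mono_on_glue[of 0 a' f a b] cuts \<open>a < a'\<close>
      by (auto simp: first_cuts_def peak_cuts_def intro: monotone_on_subset)
    then show False using assms(2) by simp
  qed
  then have "a = a'" if "a \<in> first_cuts n f" "a' \<in> first_cuts n f" for a a'
    using that by (metis linorder_neqE_nat)
  moreover obtain a where "a \<in> first_cuts n f" using assms(1) by blast
  ultimately have "first_cuts n f = {a}" by blast
  then show ?thesis by simp
qed

lemma card_first_cuts_unimodal:
  fixes f :: "nat \<Rightarrow> 'a::linorder"
  assumes "i \<in> {1..<n}" "\<And>x. 0 < x \<Longrightarrow> x \<le> n \<Longrightarrow> x \<noteq> i \<Longrightarrow> f x < f i" "peak_cuts 0 n f \<noteq> {}"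
  shows "card (first_cuts n f) = Suc i"
proof -
  have "i \<in> peak_cuts 0 n f" using peak_cuts_eq[OF _ _ assms(2,3)] assms(1) by auto
  then have inc: "strict_mono_on {0<..i} f" and dec: "strict_antimono_on {i<..n} f"
    by (auto simp: peak_cuts_def)
  have "first_cuts n f = {..i}"
  proof (intro equalityI subsetI)
    fix a assume "a \<in> first_cuts n f"
    then have a: "a < n" "strict_mono_on {0<..a} f" by (auto simp: first_cuts_def)
    show "a \<in> {..i}"
    proof (rule ccontr)
      assume "a \<notin> {..i}"
      then have "f i < f a" using assms(1) by (intro monotone_onD[OF a(2)]) auto
      then show False using assms(2)[of a] \<open>a \<notin> {..i}\<close> a(1) by fastforce
    qed
  next
    fix a assume "a \<in> {..i}"
    then have "strict_mono_on {0<..a} f" "i \<in> peak_cuts a n f"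
      using inc dec assms(1) by (auto simp: peak_cuts_def intro: monotone_on_subset)
    then show "a \<in> first_cuts n f" using \<open>a \<in> {..i}\<close> assms(1) by (auto simp: first_cuts_def)
  qed
  then show ?thesis by simp
qed

lemma cyclic_perm_invariant_superset:
  assumes "xs \<in> cyclic_perms n" "1 \<in> B" "perm_fun xs ` B \<subseteq> B"
  shows "{1..n} \<subseteq> B"
proof -
  have "iterates xs t \<in> B" for t
  proof (induction t)
    case 0
    show ?case using assms(2) by (simp add: iterates_def)
  next
    case (Suc t)
    then show ?case using assms(3) by (auto simp: iterates_Suc)
  qed
  moreover have "{1..n} = range (iterates xs)" using assms(1) by (simp only: cyclic_perms_iff)
  ultimately show ?thesis by (metis image_subsetI)
qed

definition peak :: "nat \<Rightarrow> nat list \<Rightarrow> nat" where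
  "peak n xs = inv_into {1..n} (perm_fun xs) n"

lemma perm_fun_peak:
  assumes "xs \<in> perms n" "n > 0"
  shows "peak n xs \<in> {1..n}" "perm_fun xs (peak n xs) = n"
proof -
  note bij = bij_betw_perm_fun[OF assms(1)]
  have "n \<in> {1..n}" using assms(2) by simp
  then show "peak n xs \<in> {1..n}" "perm_fun xs (peak n xs) = n"
    using bij_betw_inv_into_right[OF bij] bij_betwE[OF bij_betw_inv_into[OF bij]]
    by (auto simp: peak_def)
qed

lemma perm_fun_eq_top_iff:
  assumes "xs \<in> perms n" "x \<in> {1..n}"
  shows "perm_fun xs x = n \<longleftrightarrow> x = peak n xs"
  using bij_betw_inv_into_left[OF bij_betw_perm_fun[OF assms(1)] assms(2)]
    perm_fun_peak[OF assms(1)] assms(2)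
  by (auto simp: peak_def)

lemma perm_fun_less_peak:
  assumes "xs \<in> perms n" "x \<in> {1..n}" "x \<noteq> peak n xs"
  shows "perm_fun xs x < perm_fun xs (peak n xs)"
  using bij_betwE[OF bij_betw_perm_fun[OF assms(1)]] perm_fun_eq_top_iff[OF assms(1,2)]
    perm_fun_peak[OF assms(1)] assms(2,3)
  by fastforce

lemma cyclic_perm_peak_range:
  assumes "xs \<in> cyclic_perms n" "n \<ge> 2"
  shows "peak n xs \<in> {1..<n}"
proof -
  have xs: "xs \<in> perms n" using assms(1) by (simp add: cyclic_perms_iff)
  note bij = bij_betw_perm_fun[OF xs]
  have "n > 0" using assms(2) by simp
  note peak = perm_fun_peak[OF xs this]
  have "peak n xs \<noteq> n"
  proof
    assume "peak n xs = n"
    then have "perm_fun xs ` {1..<n} \<subseteq> {1..<n}"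
      using perm_fun_less_peak[OF xs] peak(2) bij_betwE[OF bij] by fastforce
    then have "{1..n} \<subseteq> {1..<n}"
      using assms by (intro cyclic_perm_invariant_superset) auto
    then show False using subsetD[of "{1..n}" "{1..<n}" n] assms(2) by simp
  qed
  then show ?thesis using peak(1) by simp
qed

lemma cyclic_perm_not_strict_mono:
  assumes "xs \<in> cyclic_perms n" "n \<ge> 2"
  shows "\<not> strict_mono_on {0<..n} (perm_fun xs)"
proof
  assume mono: "strict_mono_on {0<..n} (perm_fun xs)"
  have xs: "xs \<in> perms n" using assms(1) by (simp add: cyclic_perms_iff)
  note peak = cyclic_perm_peak_range[OF assms]
  have "perm_fun xs (peak n xs) < perm_fun xs n"
    using peak assms(2) by (intro monotone_onD[OF mono]) auto
  then show False using perm_fun_less_peak[OF xs, of n] peak by auto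
qed

lemma cyclic_unimodal_peak_neq_1:
  assumes "xs \<in> cyclic_perms n" "n \<ge> 3" "peak_cuts 0 n (perm_fun xs) \<noteq> {}"
  shows "peak n xs \<noteq> 1"
proof
  assume peak: "peak n xs = 1"
  define f where "f = perm_fun xs"
  have xs: "xs \<in> perms n" using assms(1) by (simp add: cyclic_perms_iff)
  note bij = bij_betw_perm_fun[OF xs, folded f_def]
  have f_one: "f 1 = n" using perm_fun_peak(2)[OF xs] peak assms(2) by (simp add: f_def)
  have "peak_cuts 0 n f = {1 - 1, 1}"
    using assms(2,3) perm_fun_less_peak[OF xs] peak by (intro peak_cuts_eq) (auto simp: f_def)
  then have dec: "strict_antimono_on {0<..n} f" by (auto simp: peak_cuts_def)
  have "1 \<in> {1..n}" using assms(2) by simp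
  then obtain x where x: "x \<in> {1..n}" "f x = 1" using bij unfolding bij_betw_def by (metis imageE)
  have "x = n"
  proof (rule ccontr)
    assume "x \<noteq> n"
    then have "f n < f x" using x(1) by (intro monotone_onD[OF dec]) auto
    moreover have "f n \<in> {1..n}" using bij_betwE[OF bij] assms(2) by simp
    ultimately show False using x(2) by simp
  qed
  then have "f ` {1, n} \<subseteq> {1, n}" using f_one x(2) by simp
  then have "{1..n} \<subseteq> {1, n}"
    using assms(1) by (intro cyclic_perm_invariant_superset) (auto simp: f_def)
  then show False using subsetD[of "{1..n}" "{1, n}" 2] assms(2) by simp
qed

lemma cyclic_unimodal_iff:
  "xs \<in> cyclic_shape_perms [True, False] n \<longleftrightarrow> xs \<in> cyclic_perms n \<and> peak_cuts 0 n (perm_fun xs) \<noteq> {}"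
  by (simp add: cyclic_shape_perms_eq segmentations_plus_minus)

lemma card_segmentations_plus_plus_minus_cyclic_perm:
  assumes "xs \<in> cyclic_perms n" "n \<ge> 2"
  shows "card (segmentations [True, True, False] n (perm_fun xs)) =
    2 * card (first_cuts n (perm_fun xs))"
  using assms cyclic_perm_not_strict_mono bij_betw_perm_fun
  by (intro card_segmentations_plus_plus_minus) (auto simp: cyclic_perms_iff bij_betw_def)

lemma card_first_cuts_cyclic_perm:
  assumes "xs \<in> cyclic_perms n" "n \<ge> 2"
  shows "card (first_cuts n (perm_fun xs)) =
    of_bool (xs \<in> cyclic_shape_perms [True, True, False] n) +
    of_bool (xs \<in> cyclic_shape_perms [True, False] n) * peak n xs"
proof -
  have xs: "xs \<in> perms n" using assms(1) by (simp add: cyclic_perms_iff)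
  note peak = cyclic_perm_peak_range[OF assms]
  have "finite (first_cuts n (perm_fun xs))" by (simp add: first_cuts_def)
  then have shape_iff:
    "xs \<in> cyclic_shape_perms [True, True, False] n \<longleftrightarrow> first_cuts n (perm_fun xs) \<noteq> {}"
    using card_segmentations_plus_plus_minus_cyclic_perm[OF assms] assms(1)
      finite_segmentations[of "[True, True, False]" n "perm_fun xs"]
    by (auto simp: cyclic_shape_perms_eq)
  show ?thesis
  proof (cases "peak_cuts 0 n (perm_fun xs) = {}")
    case True
    then show ?thesis using card_first_cuts_not_unimodal
      by (cases "first_cuts n (perm_fun xs) = {}") (auto simp: shape_iff cyclic_unimodal_iff)
  next
    case False
    then have "card (first_cuts n (perm_fun xs)) = Suc (peak n xs)"
      using peak perm_fun_less_peak[OF xs] by (intro card_first_cuts_unimodal) auto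
    then show ?thesis using False assms(1) by (auto simp: shape_iff cyclic_unimodal_iff)
  qed
qed

lemma finite_perms: "finite (perms n)"
proof (rule finite_subset)
  show "perms n \<subseteq> {xs. set xs \<subseteq> {1..n} \<and> length xs = n}" by (auto simp: perms_def)
qed (simp add: finite_lists_length_eq)

lemma finite_cyclic_perms: "finite (cyclic_perms n)"
  using finite_perms[of n] by (simp add: cyclic_perms_def)

lemma sum_peak_cyclic_unimodal:
  assumes "n \<ge> 3"
  shows "(\<Sum>xs\<in>cyclic_shape_perms [True, False] n. peak n xs) = (\<Sum>i = 2..n - 1. i * Lambda n i)"
proof -
  let ?U = "cyclic_shape_perms [True, False] n"
  have finite: "finite ?U" using finite_cyclic_perms by (simp add: cyclic_shape_perms_def)
  have "peak n xs \<in> {2..n - 1}" if "xs \<in> ?U" for xs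
    using cyclic_perm_peak_range[of xs n] cyclic_unimodal_peak_neq_1[of xs n] that assms
    by (auto simp: cyclic_unimodal_iff)
  then have "(\<Sum>xs\<in>?U. peak n xs) = (\<Sum>i = 2..n - 1. \<Sum>xs | xs \<in> ?U \<and> peak n xs = i. peak n xs)"
    using finite by (intro sum.group[symmetric]) auto
  also have "\<dots> = (\<Sum>i = 2..n - 1. i * Lambda n i)"
  proof (rule sum.cong)
    fix i assume "i \<in> {2..n - 1}"
    then have "peak n xs = i \<longleftrightarrow> perm_fun xs i = n" if "xs \<in> ?U" for xs
      using that perm_fun_eq_top_iff[of xs n i] by (auto simp: cyclic_unimodal_iff cyclic_perms_iff)
    then have "{xs \<in> ?U. peak n xs = i} = {xs \<in> ?U. perm_fun xs i = n}" by blast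
    then have "card {xs \<in> ?U. peak n xs = i} = Lambda n i" by (simp add: Lambda_def)
    moreover have "(\<Sum>xs | xs \<in> ?U \<and> peak n xs = i. peak n xs) = (\<Sum>xs | xs \<in> ?U \<and> peak n xs = i. i)"
      by (rule sum.cong) auto
    ultimately show "(\<Sum>xs | xs \<in> ?U \<and> peak n xs = i. peak n xs) = i * Lambda n i" by simp
  qed simp
  finally show ?thesis .
qed

lemma sum_card_first_cuts:
  assumes "n \<ge> 3"
  shows "(\<Sum>xs\<in>cyclic_perms n. card (first_cuts n (perm_fun xs))) =
    c5 n + (\<Sum>i = 2..n - 1. i * Lambda n i)"
proof -
  note finite = finite_cyclic_perms[of n]
  have subset: "cyclic_shape_perms \<sigma> n \<subseteq> cyclic_perms n" for \<sigma>
    by (simp add: cyclic_shape_perms_def)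
  have "(\<Sum>xs\<in>cyclic_perms n. card (first_cuts n (perm_fun xs))) =
      (\<Sum>xs\<in>cyclic_perms n. of_bool (xs \<in> cyclic_shape_perms [True, True, False] n)) +
      (\<Sum>xs\<in>cyclic_perms n. of_bool (xs \<in> cyclic_shape_perms [True, False] n) * peak n xs)"
    using assms by (simp add: card_first_cuts_cyclic_perm sum.distrib)
  also have "(\<Sum>xs\<in>cyclic_perms n. of_bool (xs \<in> cyclic_shape_perms [True, True, False] n)) = c5 n"
    using subset[of "[True, True, False]"] finite by (simp add: c5_def Int_absorb1)
  also have "(\<Sum>xs\<in>cyclic_perms n. of_bool (xs \<in> cyclic_shape_perms [True, False] n) * peak n xs) =
      (\<Sum>xs\<in>cyclic_shape_perms [True, False] n. peak n xs)"
    by (rule sum.mono_neutral_cong_right) (use subset finite in auto)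
  finally show ?thesis by (simp add: sum_peak_cyclic_unimodal[OF assms])
qed

theorem theorem4p5:
  fixes n :: nat
  assumes "n \<ge> 3"
  shows "real (c5 n) = real (L_star 3 n [True, True, False]) / 2
           - (\<Sum>i = 2..n-1. real i * real (Lambda n i))"
proof -
  have "L_star 3 n [True, True, False] = card (segmented_cyclic_perms [True, True, False] n)"
    using card_segmented_cyclic_perms[of n "[True, True, False]"] assms
    by (simp add: numeral_3_eq_3)
  also have "\<dots> = (\<Sum>xs\<in>cyclic_perms n. card (segmentations [True, True, False] n (perm_fun xs)))"
    by (simp add: segmented_cyclic_perms_def finite_cyclic_perms finite_segmentations)
  also have "\<dots> = 2 * (\<Sum>xs\<in>cyclic_perms n. card (first_cuts n (perm_fun xs)))"
    using assms by (simp add: card_segmentations_plus_plus_minus_cyclic_perm sum_distrib_left)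
  also have "\<dots> = 2 * (c5 n + (\<Sum>i = 2..n - 1. i * Lambda n i))"
    by (simp only: sum_card_first_cuts[OF assms])
  finally show ?thesis by (simp add: add_divide_distrib)
qed

end
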